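(* Let $t_0\ge 0$, let $A(t)=\begin{pmatrix} a(t)&b(t)\\ c(t)&d(t)\end{pmatrix}\in\mathbb{R}^{2\times 2}$ with $a,b,c,d$ continuous and $\det A(t)\neq 0$ for all $t\ge t_0$, and let $r:\mathbb{R}\to[0,\infty)$ be bounded and continuous. Consider the initial value problem $$DX(t)=A(t)X(t)+B_{r(t)}(\mathbf{0}),\qquad X(t_0)=B_1(\mathbf{0}), \qquad ( * )$$ for set-valued maps $X$ with values in $K_c(\mathbb{R}^2)$. If the matrix $A(t)$ has two equal singular values, $\sigma_1(t)=\sigma_2(t)=\sigma(t)$ for all $t\ge t_0$, then the problem $( * )$, with $D$ the BG-derivative $D_{bg}$ or the PS-derivative $D_{ps}$, admits two basic solutions: (i) The first basic solution $X_1(\cdot)$ (corresponding to the Hukuhara derivative, i.e. to option (i) in the definitions of the BG- and PS-derivatives) is given by $$X_1(t)=\left(G(t_0,t)+\int_{t_0}^{t}G(s,t)\,r(s)\,ds\right)B_1(\mathbf{0}),\qquad G(s,t)=e^{\int_s^t\sigma(u)\,du},\quad t\ge s\ge t_0 .$$ (ii) The second basic solution $X_2(\cdot)$ (corresponding to option (ii) in the definitions of the BG- and PS-derivatives) is given by $$X_2(t)=\left(H(t_0,t)-\int_{t_0}^{t}H(s,t)\,r(s)\,ds\right)B_1(\mathbf{0}),\qquad H(s,t)=e^{-\int_s^t\sigma(u)\,du},\quad t_0\le s\le t<\tau,$$ where $\tau>0$ is such that $\int_{t_0}^{\tau}e^{\int_{t_0}^{s}\sigma(u)\,du}\,r(s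)\,ds=1$.
   Context: $K_c(\mathbb{R}^n)$ is the space of nonempty compact convex subsets of $\mathbb{R}^n$ with the Hausdorff metric $h$; $B_\rho(\mathbf{0})=\{x:\|x\|\le \rho\}$ is the closed Euclidean ball of radius $\rho\ge0$. For $X,Y\in K_c(\mathbb{R}^n)$, $\lambda\in\mathbb{R}$ and a matrix $A$: $X+Y=\{x+y: x\in X,y\in Y\}$, $\lambda X=\{\lambda x:x\in X\}$, $AX=\{Ax:x\in X\}$. Hukuhara difference: $X\stackrel{h}{-}Y=Z$ means that $Z\in K_c(\mathbb{R}^n)$ and $X=Y+Z$ ($Z$ is unique when it exists). Derivatives of $X:[t_0,T]\to K_c(\mathbb{R}^n)$ at $t\in(t_0,T)$. In each case the Hukuhara differences involved must exist for all sufficiently small $\Delta>0$, limits are as $\Delta\to0_+$ in the Hausdorff metric, and the two limits must exist and be equal, their common value being the derivative. Hukuhara derivative $D_HX(t)$: $\lim\Delta^{-1}(X(t+\Delta)\stackrel{h}{-}X(t))=\lim\Delta^{-1}(X(t)\stackrel{h}{-}X(t-\Delta))$. BG-derivative $D_{bg}X(t)$: defined if at least one of the following holds: (i) $\lim\Delta^{-1}(X(t+\Delta)\stackrel{h}{-}X(t))=\lim\Delta^{-1}(X(t)\stackrel{h}{-}X(t-\Delta))=D_{bg}X(t)$; (ii) $\lim(-\Delta)^{-1}(X(t)\stackrel{h}{-}X(t+\Delta))=\lim(-\Delta)^{-1}(X(t-\Delta)\stackrel{h}{-}X(t))=D_{bg}X(t)$; (iii) $\lim\Delta^{-1}(X(t+\Delta)\stackrel{h}{-}X(t))=\lim(-\Delta)^{-1}(X(t-\Delta)\stackrel{h}{-}X(t))=D_{bg}X(t)$;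 (iv) $\lim(-\Delta)^{-1}(X(t)\stackrel{h}{-}X(t+\Delta))=\lim\Delta^{-1}(X(t)\stackrel{h}{-}X(t-\Delta))=D_{bg}X(t)$. PS-derivative $D_{ps}X(t)$: defined if at least one of the following holds: (i) $\lim\Delta^{-1}(X(t+\Delta)\stackrel{h}{-}X(t))=\lim\Delta^{-1}(X(t)\stackrel{h}{-}X(t-\Delta))=D_{ps}X(t)$; (ii) $\lim\Delta^{-1}(X(t)\stackrel{h}{-}X(t+\Delta))=\lim\Delta^{-1}(X(t-\Delta)\stackrel{h}{-}X(t))=D_{ps}X(t)$; (iii) $\lim\Delta^{-1}(X(t+\Delta)\stackrel{h}{-}X(t))=\lim\Delta^{-1}(X(t-\Delta)\stackrel{h}{-}X(t))=D_{ps}X(t)$; (iv) $\lim\Delta^{-1}(X(t)\stackrel{h}{-}X(t+\Delta))=\lim\Delta^{-1}(X(t)\stackrel{h}{-}X(t-\Delta))=D_{ps}X(t)$. Integral: $\int_{t_0}^tX(s)\,ds=\{\int_{t_0}^tx(s)\,ds: x \text{ a measurable selector of }X\}$. A set-valued map $X:[t_0,T]\to K_c(\mathbb{R}^2)$ is a solution of $( * )$ if it is continuous and satisfies the differential equation (or the corresponding equivalent integral equation) on $[t_0,t_1]$ for some $t_1<T$. With $R(t)=\int_{t_0}^tr(s)\,ds$ the corresponding integral equations are: for the Hukuhara derivative (option (i)), $X(t)=B_1(\mathbf{0})+\int_{t_0}^tA(s)X(s)\,ds+B_{R(t)}(\mathbf{0})$; for $D_{ps}$ with option (ii), $X(t)+\int_{t_0}^tA(s)X(s)\,ds+B_{R(t)}(\mathbf{0})=B_1(\mathbf{0})$;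 for $D_{bg}$ with option (ii), $X(t)+(-1)\int_{t_0}^tA(s)X(s)\,ds+B_{R(t)}(\mathbf{0})=B_1(\mathbf{0})$. A solution is called basic if its diameter $\operatorname{diam}(X(t))$ is a monotone function of $t$. The first basic solution is the one corresponding to option (i) of the derivative (nondecreasing diameter); the second basic solution is the one corresponding to option (ii) (decreasing diameter). *)

theory Defs
  imports "HOL-Analysis.Analysis" "HOL-Library.Set_Algebras"
begin

text \<open>Minkowski addition of sets is \<open>+\<close> from \<open>Set_Algebras\<close>; the closed ball of radius
  \<open>\<rho>\<close> about the origin is \<open>cball 0 \<rho>\<close>.\<close>

definition Kc :: "'a::euclidean_space set set" where
  "Kc = {X. X \<noteq> {} \<and> compact X \<and> convex X}"

definition hausdorff_dist :: "'a::metric_space set \<Rightarrow> 'a set \<Rightarrow> real" where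
  "hausdorff_dist X Y = max (SUP x\<in>X. infdist x Y) (SUP y\<in>Y. infdist y X)"

definition set_scale :: "real \<Rightarrow> 'a::real_vector set \<Rightarrow> 'a set" where
  "set_scale c X = (\<lambda>x. c *\<^sub>R x) ` X"

definition set_mat_mult :: "real^'n^'m \<Rightarrow> (real^'n) set \<Rightarrow> (real^'m) set" where
  "set_mat_mult A X = (\<lambda>x. A *v x) ` X"

definition is_hukuhara_diff :: "'a::euclidean_space set \<Rightarrow> 'a set \<Rightarrow> 'a set \<Rightarrow> bool" where
  "is_hukuhara_diff X Y Z \<longleftrightarrow> Z \<in> Kc \<and> X = Y + Z"

definition hukuhara_diff :: "'a::euclidean_space set \<Rightarrow> 'a set \<Rightarrow> 'a set" where
  "hukuhara_diff X Y = (THE Z. is_hukuhara_diff X Y Z)"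

text \<open>\<open>hukuhara_lim c P Q Z\<close>: the Hukuhara differences of \<open>P \<Delta>\<close> and \<open>Q \<Delta>\<close> exist for all
  sufficiently small \<open>\<Delta> > 0\<close> and, multiplied by \<open>c \<Delta>\<close>, tend to \<open>Z\<close> in the Hausdorff metric
  as \<open>\<Delta> \<rightarrow> 0+\<close>.\<close>

definition hukuhara_lim ::
  "(real \<Rightarrow> real) \<Rightarrow> (real \<Rightarrow> 'a::euclidean_space set) \<Rightarrow> (real \<Rightarrow> 'a set) \<Rightarrow> 'a set \<Rightarrow> bool" where
  "hukuhara_lim c P Q Z \<longleftrightarrow>
     Z \<in> Kc \<and>
     (\<forall>\<^sub>F \<Delta> in at_right 0. \<exists>W. is_hukuhara_diff (P \<Delta>) (Q \<Delta>) W) \<and>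
     ((\<lambda>\<Delta>. hausdorff_dist (set_scale (c \<Delta>) (hukuhara_diff (P \<Delta>) (Q \<Delta>))) Z) \<longlongrightarrow> 0) (at_right 0)"

definition has_hukuhara_derivative ::
  "(real \<Rightarrow> 'a::euclidean_space set) \<Rightarrow> real \<Rightarrow> 'a set \<Rightarrow> bool" where
  "has_hukuhara_derivative X t Z \<longleftrightarrow>
     hukuhara_lim (\<lambda>\<Delta>. inverse \<Delta>) (\<lambda>\<Delta>. X (t + \<Delta>)) (\<lambda>_. X t) Z \<and>
     hukuhara_lim (\<lambda>\<Delta>. inverse \<Delta>) (\<lambda>_. X t) (\<lambda>\<Delta>. X (t - \<Delta>)) Z"

datatype deriv_kind = BG | PS

datatype deriv_case = Case_i | Case_ii | Case_iii | Case_iv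

fun has_derivative_case ::
  "deriv_kind \<Rightarrow> deriv_case \<Rightarrow> (real \<Rightarrow> 'a::euclidean_space set) \<Rightarrow> real \<Rightarrow> 'a set \<Rightarrow> bool" where
  "has_derivative_case BG Case_i X t Z \<longleftrightarrow> has_hukuhara_derivative X t Z"
| "has_derivative_case BG Case_ii X t Z \<longleftrightarrow>
     hukuhara_lim (\<lambda>\<Delta>. inverse (- \<Delta>)) (\<lambda>_. X t) (\<lambda>\<Delta>. X (t + \<Delta>)) Z \<and>
     hukuhara_lim (\<lambda>\<Delta>. inverse (- \<Delta>)) (\<lambda>\<Delta>. X (t - \<Delta>)) (\<lambda>_. X t) Z"
| "has_derivative_case BG Case_iii X t Z \<longleftrightarrow>
     hukuhara_lim (\<lambda>\<Delta>. inverse \<Delta>) (\<lambda>\<Delta>. X (t + \<Delta>)) (\<lambda>_. X t) Z \<and>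
     hukuhara_lim (\<lambda>\<Delta>. inverse (- \<Delta>)) (\<lambda>\<Delta>. X (t - \<Delta>)) (\<lambda>_. X t) Z"
| "has_derivative_case BG Case_iv X t Z \<longleftrightarrow>
     hukuhara_lim (\<lambda>\<Delta>. inverse (- \<Delta>)) (\<lambda>_. X t) (\<lambda>\<Delta>. X (t + \<Delta>)) Z \<and>
     hukuhara_lim (\<lambda>\<Delta>. inverse \<Delta>) (\<lambda>_. X t) (\<lambda>\<Delta>. X (t - \<Delta>)) Z"
| "has_derivative_case PS Case_i X t Z \<longleftrightarrow> has_hukuhara_derivative X t Z"
| "has_derivative_case PS Case_ii X t Z \<longleftrightarrow>
     hukuhara_lim (\<lambda>\<Delta>. inverse \<Delta>) (\<lambda>_. X t) (\<lambda>\<Delta>. X (t + \<Delta>)) Z \<and>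
     hukuhara_lim (\<lambda>\<Delta>. inverse \<Delta>) (\<lambda>\<Delta>. X (t - \<Delta>)) (\<lambda>_. X t) Z"
| "has_derivative_case PS Case_iii X t Z \<longleftrightarrow>
     hukuhara_lim (\<lambda>\<Delta>. inverse \<Delta>) (\<lambda>\<Delta>. X (t + \<Delta>)) (\<lambda>_. X t) Z \<and>
     hukuhara_lim (\<lambda>\<Delta>. inverse \<Delta>) (\<lambda>\<Delta>. X (t - \<Delta>)) (\<lambda>_. X t) Z"
| "has_derivative_case PS Case_iv X t Z \<longleftrightarrow>
     hukuhara_lim (\<lambda>\<Delta>. inverse \<Delta>) (\<lambda>_. X t) (\<lambda>\<Delta>. X (t + \<Delta>)) Z \<and>
     hukuhara_lim (\<lambda>\<Delta>. inverse \<Delta>) (\<lambda>_. X t) (\<lambda>\<Delta>. X (t - \<Delta>)) Z"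

text \<open>A relation rather than a function: cases (i) and (ii) of the PS-derivative may both hold, with
  opposite values, for instance when \<open>X\<close> is single-valued.\<close>

definition has_set_derivative ::
  "deriv_kind \<Rightarrow> (real \<Rightarrow> 'a::euclidean_space set) \<Rightarrow> real \<Rightarrow> 'a set \<Rightarrow> bool" where
  "has_set_derivative k X t Z \<longleftrightarrow> (\<exists>j. has_derivative_case k j X t Z)"

text \<open>Absolute integrability includes Lebesgue measurability of the selector, and is automatic for a
  measurable selector of a bounded \<open>F\<close>.\<close>

definition aumann_integral ::
  "real \<Rightarrow> real \<Rightarrow> (real \<Rightarrow> 'a::euclidean_space set) \<Rightarrow> 'a set" where
  "aumann_integral a b F =
     {integral {a..b} x |x. x absolutely_integrable_on {a..b} \<and> (\<forall>s\<in>{a..b}. x s \<in> F s)}"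

text \<open>\<open>s\<close> lists the singular values of \<open>A\<close> with multiplicity: the nonnegative square roots of the
  roots of the characteristic polynomial of \<open>A\<^sup>T A\<close>.\<close>

definition singular_values :: "real^'n^'m \<Rightarrow> real^'n \<Rightarrow> bool" where
  "singular_values A s \<longleftrightarrow>
     (\<forall>i. 0 \<le> s $ i) \<and>
     (\<forall>x. det (mat x - transpose A ** A) = (\<Prod>i\<in>UNIV. x - (s $ i)\<^sup>2))"

definition set_continuous_on :: "real set \<Rightarrow> (real \<Rightarrow> 'a::euclidean_space set) \<Rightarrow> bool" where
  "set_continuous_on S X \<longleftrightarrow>
     (\<forall>t\<in>S. ((\<lambda>s. hausdorff_dist (X s) (X t)) \<longlongrightarrow> 0) (at t within S))"

text \<open>The maps \<open>X\<close> live on \<open>{t0..T}\<close> and satisfy the equation on \<open>{t0..t1}\<close>, where \<open>t0 < t1 < T\<close>.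
  Derivatives are only defined on the open interval from \<open>t0\<close> to \<open>T\<close>, so the differential equation
  concerns the points of \<open>{t0<..t1}\<close>.\<close>

definition admissible_map ::
  "real \<Rightarrow> real \<Rightarrow> real \<Rightarrow> (real \<Rightarrow> (real^2) set) \<Rightarrow> bool" where
  "admissible_map t0 t1 T X \<longleftrightarrow>
     t0 < t1 \<and> t1 < T \<and> (\<forall>t\<in>{t0..T}. X t \<in> Kc) \<and> set_continuous_on {t0..T} X"

definition diff_solution ::
  "((real \<Rightarrow> (real^2) set) \<Rightarrow> real \<Rightarrow> (real^2) set \<Rightarrow> bool) \<Rightarrow>
   (real \<Rightarrow> real^2^2) \<Rightarrow> (real \<Rightarrow> real) \<Rightarrow> real \<Rightarrow> real \<Rightarrow> real \<Rightarrow> (real \<Rightarrow> (real^2) set) \<Rightarrow> bool" where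
  "diff_solution D A r t0 t1 T X \<longleftrightarrow>
     admissible_map t0 t1 T X \<and> X t0 = cball 0 1 \<and>
     (\<forall>t\<in>{t0<..t1}. D X t (set_mat_mult (A t) (X t) + cball 0 (r t)))"

definition int_solution_i ::
  "(real \<Rightarrow> real^2^2) \<Rightarrow> (real \<Rightarrow> real) \<Rightarrow> real \<Rightarrow> real \<Rightarrow> real \<Rightarrow> (real \<Rightarrow> (real^2) set) \<Rightarrow> bool" where
  "int_solution_i A r t0 t1 T X \<longleftrightarrow>
     admissible_map t0 t1 T X \<and>
     (\<forall>t\<in>{t0..t1}. X t =
        cball 0 1 + aumann_integral t0 t (\<lambda>s. set_mat_mult (A s) (X s)) + cball 0 (integral {t0..t} r))"

fun int_solution_ii ::
  "deriv_kind \<Rightarrow> (real \<Rightarrow> real^2^2) \<Rightarrow> (real \<Rightarrow> real) \<Rightarrow> real \<Rightarrow> real \<Rightarrow> real \<Rightarrow>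
   (real \<Rightarrow> (real^2) set) \<Rightarrow> bool" where
  "int_solution_ii BG A r t0 t1 T X \<longleftrightarrow>
     admissible_map t0 t1 T X \<and>
     (\<forall>t\<in>{t0..t1}.
        X t + set_scale (-1) (aumann_integral t0 t (\<lambda>s. set_mat_mult (A s) (X s)))
          + cball 0 (integral {t0..t} r) = cball 0 1)"
| "int_solution_ii PS A r t0 t1 T X \<longleftrightarrow>
     admissible_map t0 t1 T X \<and>
     (\<forall>t\<in>{t0..t1}.
        X t + aumann_integral t0 t (\<lambda>s. set_mat_mult (A s) (X s))
          + cball 0 (integral {t0..t} r) = cball 0 1)"

definition basic_solution ::
  "deriv_kind \<Rightarrow> (real \<Rightarrow> real^2^2) \<Rightarrow> (real \<Rightarrow> real) \<Rightarrow> real \<Rightarrow> real \<Rightarrow> real \<Rightarrow>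
   (real \<Rightarrow> (real^2) set) \<Rightarrow> bool" where
  "basic_solution k A r t0 t1 T X \<longleftrightarrow>
     diff_solution (has_set_derivative k) A r t0 t1 T X \<and>
     (mono_on {t0..t1} (\<lambda>t. diameter (X t)) \<or> antimono_on {t0..t1} (\<lambda>t. diameter (X t)))"

text \<open>The differential equation and the integral equation are interchangeable descriptions of a
  solution; the two predicates below demand both.\<close>

definition first_basic_solution ::
  "deriv_kind \<Rightarrow> (real \<Rightarrow> real^2^2) \<Rightarrow> (real \<Rightarrow> real) \<Rightarrow> real \<Rightarrow> real \<Rightarrow> real \<Rightarrow>
   (real \<Rightarrow> (real^2) set) \<Rightarrow> bool" where
  "first_basic_solution k A r t0 t1 T X \<longleftrightarrow>
     basic_solution k A r t0 t1 T X \<and>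
     diff_solution (has_derivative_case k Case_i) A r t0 t1 T X \<and>
     int_solution_i A r t0 t1 T X \<and>
     mono_on {t0..t1} (\<lambda>t. diameter (X t))"

text \<open>The diameter decreases strictly as long as it is positive; once \<open>X\<close> has shrunk to a point
  (possible when \<open>r\<close> vanishes from then on) it stays zero.\<close>

definition second_basic_solution ::
  "deriv_kind \<Rightarrow> (real \<Rightarrow> real^2^2) \<Rightarrow> (real \<Rightarrow> real) \<Rightarrow> real \<Rightarrow> real \<Rightarrow> real \<Rightarrow>
   (real \<Rightarrow> (real^2) set) \<Rightarrow> bool" where
  "second_basic_solution k A r t0 t1 T X \<longleftrightarrow>
     basic_solution k A r t0 t1 T X \<and>
     diff_solution (has_derivative_case k Case_ii) A r t0 t1 T X \<and>
     int_solution_ii k A r t0 t1 T X \<and>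
     antimono_on {t0..t1} (\<lambda>t. diameter (X t)) \<and>
     (\<forall>s\<in>{t0..t1}. \<forall>t\<in>{t0..t1}. s < t \<and> 0 < diameter (X s) \<longrightarrow> diameter (X t) < diameter (X s))"

end

theory Submission
  imports Defs
begin

text \<open>Equal singular values make \<open>A(t)\<close> a multiple \<open>\<sigma>(t)\<close> of an orthogonal matrix, so \<open>A(t)\<close> maps the ball of
  radius \<open>\<rho>\<close> onto the ball of radius \<open>\<sigma>(t) \<rho>\<close>. For a ball of radius \<open>g(t)\<close> both the differential and the
  integral equation then reduce to the linear equation \<open>g' = \<plusminus>(\<sigma> g + r)\<close> with \<open>g(t0) = 1\<close>.

  Uniqueness uses support functions \<open>s(t, p)\<close>. Every solution, of the differential or of the integral
  equation, satisfies \<open>s'(t, p) = \<plusminus>(s(t, \<plusminus>A\<^sup>T p) + r(t) |p|)\<close> with \<open>s(t0, p) = |p|\<close>. The difference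
  \<open>u\<close> of two solutions satisfies \<open>|u'(t, p)| \<le> |u(t, \<plusminus>A\<^sup>T p)|\<close>, and iterating this bound gives
  \<open>|u(t, p)| \<le> C (K (t - t0))\<^sup>n |p| / n!\<close> for all \<open>n\<close>.\<close>

subsection \<open>Support functions\<close>

text \<open>Minkowski addition has no inverse: in option (ii) the unknown stands next to other
  summands, and Hukuhara differences exist only sometimes. Support functions turn sums and existing
  differences into ordinary ones and determine a compact convex set, so nothing set-valued has to be
  subtracted. The price: the equation at a direction \<open>p\<close> involves the value at the
  direction \<open>p v* A t\<close>, so for fixed \<open>p\<close> there is no closed scalar
  equation and a scalar Gronwall estimate does not apply; hence the iteration over directions. For
  the integral equations the obstacle is the support function of an Aumann integral: its lower bound
  needs integrable selectors that nearly maximise the inner product with a direction. Continuity of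
  \<open>X\<close> supplies continuous ones through nearest points. The sign \<open>-1\<close> of
  the BG variant only reflects sets, which leaves centred balls unchanged; so both kinds of
  derivative share the same formulas.\<close>

definition supp :: "'a::euclidean_space set \<Rightarrow> 'a \<Rightarrow> real" where
  "supp X p = (SUP x\<in>X. p \<bullet> x)"

lemma inner_le_supp:
  assumes "bounded X" "x \<in> X"
  shows "p \<bullet> x \<le> supp X p"
  unfolding supp_def
proof (rule cSUP_upper[OF assms(2)])
  show "bdd_above ((\<bullet>) p ` X)"
    by (intro bounded_imp_bdd_above bounded_linear_image assms bounded_linear_inner_right)
qed

lemma supp_le: "X \<noteq> {} \<Longrightarrow> (\<And>x. x \<in> X \<Longrightarrow> p \<bullet> x \<le> m) \<Longrightarrow> supp X p \<le> m"
  unfolding supp_def by (rule cSUP_least)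

lemma set_plus_nonempty: "X \<noteq> {} \<Longrightarrow> Y \<noteq> {} \<Longrightarrow> X + Y \<noteq> {}"
  by (auto simp: set_plus_def)

lemma bounded_set_plus:
  fixes X Y :: "'a::real_normed_vector set"
  assumes "bounded X" "bounded Y"
  shows "bounded (X + Y)"
  using bounded_sums[OF assms] by (rule back_subst[of bounded]) (auto simp: set_plus_def)

lemma supp_plus:
  assumes X: "X \<noteq> {}" "bounded X" and Y: "Y \<noteq> {}" "bounded Y"
  shows "supp (X + Y) p = supp X p + supp Y p"
proof (rule antisym)
  show "supp (X + Y) p \<le> supp X p + supp Y p"
    using inner_le_supp[OF X(2)] inner_le_supp[OF Y(2)]
    by (intro supp_le set_plus_nonempty X Y)
      (auto simp: set_plus_def inner_add_right intro!: add_mono)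
  have sum_le: "p \<bullet> x + p \<bullet> y \<le> supp (X + Y) p" if "x \<in> X" "y \<in> Y" for x y
    using inner_le_supp[OF bounded_set_plus[OF X(2) Y(2)], of "x + y" p] that
    by (auto simp: set_plus_def inner_add_right)
  have "supp X p \<le> supp (X + Y) p - p \<bullet> y" if "y \<in> Y" for y
    using sum_le[OF _ that] by (intro supp_le X) (simp add: algebra_simps)
  then have "supp Y p \<le> supp (X + Y) p - supp X p"
    by (intro supp_le Y) (simp add: algebra_simps)
  then show "supp X p + supp Y p \<le> supp (X + Y) p" by simp
qed

text \<open>A negative factor moves into the direction; this is how the reflection in option (ii) of
  the BG-derivative is carried along.\<close>

lemma supp_set_scale: "supp (set_scale c X) p = supp X (c *\<^sub>R p)"
  by (simp add: supp_def set_scale_def image_image)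

lemma supp_scaleR:
  assumes X: "X \<noteq> {}" "bounded X" and c: "0 \<le> c"
  shows "supp X (c *\<^sub>R p) = c * supp X p"
proof -
  have le: "supp X (c *\<^sub>R p) \<le> c * supp X p" if "0 \<le> c" for c p
    using inner_le_supp[OF X(2)] that by (intro supp_le X) (auto intro: mult_left_mono)
  show ?thesis
  proof (cases "c = 0")
    case True
    then show ?thesis using X by (simp add: supp_def)
  next
    case False
    \<comment> \<open>The reverse inequality is \<open>le\<close> again, for the factor
      \<open>1/c\<close> and the direction \<open>c *\<^sub>R p\<close>.\<close>
    with c have "supp X ((1/c) *\<^sub>R c *\<^sub>R p) \<le> (1/c) * supp X (c *\<^sub>R p)"
      by (intro le) auto
    with False c have "c * supp X p \<le> supp X (c *\<^sub>R p)"
      by (simp add: field_simps)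
    with le[OF c] show ?thesis by (intro antisym)
  qed
qed

lemma supp_set_mat_mult:
  fixes A :: "real^'n^'m"
  shows "supp (set_mat_mult A X) p = supp X (p v* A)"
  by (simp add: supp_def set_mat_mult_def image_image dot_lmul_matrix)

lemma supp_cball:
  assumes "0 \<le> \<rho>"
  shows "supp (cball 0 \<rho>) p = \<rho> * norm p"
proof (rule antisym)
  show "supp (cball 0 \<rho>) p \<le> \<rho> * norm p"
  proof (rule supp_le)
    fix x :: 'a assume "x \<in> cball 0 \<rho>"
    then show "p \<bullet> x \<le> \<rho> * norm p"
      using norm_cauchy_schwarz[of p x] mult_left_mono[of "norm x" \<rho> "norm p"]
      by (simp add: mult.commute)
  qed (use assms in auto)
  \<comment> \<open>The maximiser lies on the ray through \<open>p\<close>; since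
    \<open>sgn 0 = 0\<close>, it stays in the ball for \<open>p = 0\<close> as well.\<close>
  have "p \<bullet> (\<rho> *\<^sub>R sgn p) \<le> supp (cball 0 \<rho>) p"
    using assms by (intro inner_le_supp) (auto simp: norm_sgn)
  moreover have "p \<bullet> (\<rho> *\<^sub>R sgn p) = \<rho> * norm p"
    by (cases "p = 0") (auto simp: sgn_div_norm dot_square_norm power2_eq_square)
  ultimately show "\<rho> * norm p \<le> supp (cball 0 \<rho>) p" by (simp only:)
qed

lemma abs_supp_le:
  assumes X: "X \<noteq> {}" and C: "X \<subseteq> cball 0 C"
  shows "\<bar>supp X p\<bar> \<le> C * norm p"
proof -
  have b: "bounded X" using C bounded_cball bounded_subset by blast
  have i: "\<bar>p \<bullet> x\<bar> \<le> C * norm p" if "x \<in> X" for x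
    using Cauchy_Schwarz_ineq2[of p x] mult_left_mono[of "norm x" C "norm p"] C that
    by (auto simp: mult.commute)
  then have "supp X p \<le> C * norm p" by (intro supp_le X) force
  moreover from X obtain x where "x \<in> X" by auto
  ultimately show ?thesis using i[of x] inner_le_supp[OF b, of x p] by linarith
qed

text \<open>The basis vectors and their negatives control every coordinate, so bounds on finitely
  many support values already give boundedness.\<close>

lemma norm_le_inner_bounds:
  fixes x :: "'a::euclidean_space"
  assumes "\<And>p. p \<bullet> x \<le> m p"
  shows "norm x \<le> (\<Sum>b\<in>Basis. \<bar>m b\<bar> + \<bar>m (- b)\<bar>)"
proof -
  have "\<bar>x \<bullet> b\<bar> \<le> \<bar>m b\<bar> + \<bar>m (- b)\<bar>" for b
    using assms[of b] assms[of "- b"] by (simp add: inner_commute)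
  then show ?thesis using norm_le_l1[of x] by (meson order_trans sum_mono)
qed

lemma Kc_D: "X \<in> Kc \<Longrightarrow> X \<noteq> {}" "X \<in> Kc \<Longrightarrow> bounded X" "X \<in> Kc \<Longrightarrow> closed X"
  "X \<in> Kc \<Longrightarrow> convex X" "X \<in> Kc \<Longrightarrow> compact X"
  by (auto simp: Kc_def compact_imp_bounded compact_imp_closed)

lemma cball_Kc: "0 \<le> \<rho> \<Longrightarrow> cball 0 \<rho> \<in> Kc"
  by (auto simp: Kc_def)

text \<open>Separation: a point outside the closed convex \<open>Y\<close> is cut off by a
  hyperplane, and the negative of its normal is a direction that violates the inequality.\<close>

lemma subset_of_supp_le:
  assumes X: "bounded X" and Y: "Y \<in> Kc" and le: "\<And>p. supp X p \<le> supp Y p"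
  shows "X \<subseteq> Y"
proof
  fix x assume x: "x \<in> X"
  show "x \<in> Y"
  proof (rule ccontr)
    assume "x \<notin> Y"
    then obtain a b where ab: "a \<bullet> x < b" "\<forall>y\<in>Y. a \<bullet> y > b"
      using separating_hyperplane_closed_point Kc_D[OF Y] by metis
    have "supp Y (- a) \<le> - b" using ab Y by (intro supp_le Kc_D) (auto intro: less_imp_le)
    moreover have "(- a) \<bullet> x \<le> supp X (- a)" by (rule inner_le_supp[OF X x])
    ultimately show False using le[of "- a"] ab(1) by simp
  qed
qed

lemma supp_inject:
  assumes "X \<in> Kc" "Y \<in> Kc" "\<And>p. supp X p = supp Y p"
  shows "X = Y"
  using assms by (intro antisym subset_of_supp_le Kc_D) auto

text \<open>Unfolding the \<open>THE\<close> calls for uniqueness, which is the cancellation law for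
  Minkowski sums: support functions add, so the common summand drops out.\<close>

lemma hukuhara_diff_eq:
  assumes "is_hukuhara_diff X Y Z" "Y \<in> Kc"
  shows "hukuhara_diff X Y = Z"
  unfolding hukuhara_diff_def
proof (rule the_equality[where P = "is_hukuhara_diff X Y", OF assms(1)])
  fix W assume W: "is_hukuhara_diff X Y W"
  have Kc: "W \<in> Kc" "Z \<in> Kc" using W assms by (auto simp: is_hukuhara_diff_def)
  have eq: "X = Y + W" "X = Y + Z"
    using W assms unfolding is_hukuhara_diff_def by blast+
  then have "supp (Y + W) p = supp (Y + Z) p" for p by simp
  then show "W = Z"
    by (intro supp_inject Kc) (simp add: supp_plus Kc_D assms Kc)
qed

subsection \<open>The Hausdorff distance and Hukuhara limits\<close>

lemma bdd_above_infdist: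
  assumes "bounded X" "Y \<noteq> {}"
  shows "bdd_above ((\<lambda>x. infdist x Y) ` X)"
proof -
  from assms(2) obtain y where y: "y \<in> Y" by auto
  obtain e where "\<And>x. x \<in> X \<Longrightarrow> dist y x \<le> e"
    using bounded_any_center[of X y] assms(1) by blast
  then show ?thesis
    by (intro bdd_aboveI2[of _ _ e]) (metis dist_commute infdist_le2 y)
qed

lemma hausdorff_dist_ge:
  assumes "bounded X" "Y \<noteq> {}" "x \<in> X"
  shows "infdist x Y \<le> hausdorff_dist X Y"
  unfolding hausdorff_dist_def
  by (intro max.coboundedI1 cSUP_upper assms bdd_above_infdist)

lemma hausdorff_dist_commute: "hausdorff_dist X Y = hausdorff_dist Y X"
  by (simp add: hausdorff_dist_def max.commute)

lemma hausdorff_dist_nearest: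
  fixes X Y :: "'a::euclidean_space set"
  assumes "bounded X" "Y \<noteq> {}" "closed Y" "x \<in> X"
  obtains y where "y \<in> Y" "dist x y \<le> hausdorff_dist X Y"
  by (metis infdist_attains_inf hausdorff_dist_ge assms)

lemma hausdorff_dist_nonneg:
  assumes "bounded X" "X \<noteq> {}" "Y \<noteq> {}"
  shows "0 \<le> hausdorff_dist X Y"
  using hausdorff_dist_ge[OF assms(1,3)] assms(2) infdist_nonneg order_trans by blast

lemma hausdorff_dist_leI:
  assumes "X \<noteq> {}" "Y \<noteq> {}"
    and "\<And>x. x \<in> X \<Longrightarrow> \<exists>y\<in>Y. dist x y \<le> \<delta>" "\<And>y. y \<in> Y \<Longrightarrow> \<exists>x\<in>X. dist y x \<le> \<delta>"
  shows "hausdorff_dist X Y \<le> \<delta>"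
  unfolding hausdorff_dist_def
  using assms by (intro max.boundedI cSUP_least) (meson infdist_le2)+

text \<open>Passing from a point of one set to a nearest point of the other changes the inner
  product with \<open>p\<close> by at most the bound. Hausdorff limits thus become limits of support
  functions in each direction.\<close>

lemma supp_diff_le_hausdorff:
  fixes X Y :: "'a::euclidean_space set"
  assumes X: "X \<in> Kc" and Y: "Y \<in> Kc"
  shows "\<bar>supp X p - supp Y p\<bar> \<le> norm p * hausdorff_dist X Y"
proof -
  have *: "supp X p \<le> supp Y p + norm p * hausdorff_dist X Y"
    if "X \<in> Kc" "Y \<in> Kc" for X Y :: "'a set"
  proof (rule supp_le)
    fix x assume "x \<in> X"
    with that obtain y where y: "y \<in> Y" "dist x y \<le> hausdorff_dist X Y"
      using hausdorff_dist_nearest[of X Y x] Kc_D by metis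
    have "p \<bullet> x = p \<bullet> y + p \<bullet> (x - y)" by (simp add: inner_diff_right)
    also have "p \<bullet> (x - y) \<le> norm p * norm (x - y)" by (rule norm_cauchy_schwarz)
    also have "norm p * norm (x - y) \<le> norm p * hausdorff_dist X Y"
      using y(2) by (intro mult_left_mono) (auto simp: dist_norm)
    also have "p \<bullet> y \<le> supp Y p" using that y by (intro inner_le_supp Kc_D)
    finally show "p \<bullet> x \<le> supp Y p + norm p * hausdorff_dist X Y" by simp
  qed (use that Kc_D in auto)
  show ?thesis
    using *[OF X Y] *[OF Y X] by (simp add: hausdorff_dist_commute[of Y X] abs_le_iff)
qed

lemma tendsto_supp:
  assumes "\<forall>\<^sub>F x in F. P x \<in> Kc" "Z \<in> Kc" "((\<lambda>x. hausdorff_dist (P x) Z) \<longlongrightarrow> 0) F"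
  shows "((\<lambda>x. supp (P x) p) \<longlongrightarrow> supp Z p) F"
proof -
  have "((\<lambda>x. norm p * hausdorff_dist (P x) Z) \<longlongrightarrow> 0) F"
    using tendsto_mult_right_zero[OF assms(3)] by simp
  then have "((\<lambda>x. supp (P x) p - supp Z p) \<longlongrightarrow> 0) F"
    by (rule Lim_null_comparison[rotated])
      (use assms(1,2) in \<open>auto elim!: eventually_mono intro: supp_diff_le_hausdorff\<close>)
  then show ?thesis by (rule LIM_zero_cancel)
qed

lemma hausdorff_dist_cball_le:
  fixes x y :: real
  assumes "0 \<le> x" "0 \<le> y"
  shows "hausdorff_dist (cball (0::'a::euclidean_space) x) (cball 0 y) \<le> \<bar>x - y\<bar>"
proof -
  have *: "\<exists>w\<in>cball 0 y. dist z w \<le> \<bar>x - y\<bar>"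
    if "0 \<le> x" "0 \<le> y" "z \<in> cball 0 x" for x y and z :: 'a
  proof (cases "norm z \<le> y")
    case True
    then show ?thesis by (intro bexI[of _ z]) auto
  next
    case False
    then have z: "norm z > 0" using that by linarith
    \<comment> \<open>The witness is the radial projection of \<open>z\<close> onto the sphere of
      radius \<open>y\<close>.\<close>
    have "z - (y / norm z) *\<^sub>R z = (1 - y / norm z) *\<^sub>R z" by (simp add: algebra_simps)
    then have "dist z ((y / norm z) *\<^sub>R z) = \<bar>1 - y / norm z\<bar> * norm z"
      by (simp add: dist_norm)
    also have "\<dots> = norm z - y" using z False by (simp add: abs_if field_simps)
    also have "\<dots> \<le> \<bar>x - y\<bar>" using that by simp
    finally show ?thesis using z that
      by (intro bexI[of _ "(y / norm z) *\<^sub>R z"]) auto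
  qed
  show ?thesis
    using *[OF assms] *[OF assms(2,1)] assms
    by (intro hausdorff_dist_leI) (auto simp: abs_minus_commute[of y x])
qed

lemma set_plus_cball:
  fixes x y :: real
  assumes "0 \<le> x" "0 \<le> y"
  shows "cball (0::'a::euclidean_space) x + cball 0 y = cball 0 (x + y)"
proof
  show "cball (0::'a) x + cball 0 y \<subseteq> cball 0 (x + y)"
    by (auto simp: set_plus_def intro: norm_triangle_mono)
  show "cball (0::'a) (x + y) \<subseteq> cball 0 x + cball 0 y"
  proof
    fix z :: 'a assume z: "z \<in> cball 0 (x + y)"
    show "z \<in> cball 0 x + cball 0 y"
    proof (cases "x + y = 0")
      case True
      with assms have "x = 0" "y = 0" by auto
      with z show ?thesis by (auto simp: set_plus_def)
    next
      case False
      with assms have pos: "x + y > 0" by auto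
      have *: "(w / (x + y)) *\<^sub>R z \<in> cball 0 w" if "0 \<le> w" for w
        using that pos z mult_left_mono[of "norm z" "x + y" w] by (auto simp: field_simps)
      \<comment> \<open>Splitting \<open>z\<close> in the proportion of the radii puts each part
        into its ball.\<close>
      have "z = (x / (x + y)) *\<^sub>R z + (y / (x + y)) *\<^sub>R z"
        using pos by (simp flip: scaleR_left_distrib add_divide_distrib)
      then show ?thesis using *[OF assms(1)] *[OF assms(2)] set_plus_intro by metis
    qed
  qed
qed

lemma set_scale_cball:
  assumes "0 \<le> \<rho>"
  shows "set_scale c (cball (0::'a::euclidean_space) \<rho>) = cball 0 (\<bar>c\<bar> * \<rho>)"
  using assms cball_scale[of c "0::'a" \<rho>] by (cases "c = 0") (auto simp: set_scale_def intro: image_eqI[of _ _ 0])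

lemma is_hukuhara_diff_cball:
  assumes "0 \<le> y" "y \<le> x"
  shows "is_hukuhara_diff (cball (0::'a::euclidean_space) x) (cball 0 y) (cball 0 (x - y))"
  using assms by (auto simp: is_hukuhara_diff_def cball_Kc set_plus_cball)

text \<open>The factor \<open>e = \<plusminus>1\<close> lets the BG- and the PS-variants of the limits be treated together.\<close>

lemma hukuhara_lim_cball:
  fixes P Q :: "real \<Rightarrow> 'a::euclidean_space set"
  assumes e: "\<bar>e\<bar> = 1"
    and ev: "\<forall>\<^sub>F \<Delta> in at_right 0. P \<Delta> = cball 0 (p \<Delta>) \<and> Q \<Delta> = cball 0 (q \<Delta>) \<and> 0 \<le> q \<Delta> \<and> q \<Delta> \<le> p \<Delta>"
    and lim: "((\<lambda>\<Delta>. (p \<Delta> - q \<Delta>) / \<Delta>) \<longlongrightarrow> z) (at_right 0)"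
    and z: "0 \<le> z"
  shows "hukuhara_lim (\<lambda>\<Delta>. inverse (e * \<Delta>)) P Q (cball 0 z)"
  unfolding hukuhara_lim_def
proof (intro conjI)
  show "cball 0 z \<in> Kc" using z by (rule cball_Kc)
  show "\<forall>\<^sub>F \<Delta> in at_right 0. \<exists>W. is_hukuhara_diff (P \<Delta>) (Q \<Delta>) W"
    using ev by eventually_elim (metis is_hukuhara_diff_cball)
  have pos: "\<forall>\<^sub>F \<Delta> in at_right (0::real). \<Delta> > 0" by (rule eventually_at_right_less)
  have bound: "\<forall>\<^sub>F \<Delta> in at_right 0.
      norm (hausdorff_dist (set_scale (inverse (e * \<Delta>)) (hukuhara_diff (P \<Delta>) (Q \<Delta>))) (cball 0 z))
      \<le> \<bar>(p \<Delta> - q \<Delta>) / \<Delta> - z\<bar>"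
    using ev pos
  proof eventually_elim
    case (elim \<Delta>)
    then have "hukuhara_diff (P \<Delta>) (Q \<Delta>) = cball 0 (p \<Delta> - q \<Delta>)"
      using hukuhara_diff_eq[OF is_hukuhara_diff_cball] cball_Kc by metis
    moreover have "set_scale (inverse (e * \<Delta>)) (cball (0::'a) (p \<Delta> - q \<Delta>)) = cball 0 ((p \<Delta> - q \<Delta>) / \<Delta>)"
      using elim e by (simp add: set_scale_cball abs_mult divide_inverse mult.commute)
    moreover have "0 \<le> (p \<Delta> - q \<Delta>) / \<Delta>" using elim by simp
    ultimately show ?case
      using hausdorff_dist_cball_le[of "(p \<Delta> - q \<Delta>) / \<Delta>" z, where 'a='a] z
        hausdorff_dist_nonneg[of "cball (0::'a) ((p \<Delta> - q \<Delta>) / \<Delta>)" "cball 0 z"] by simp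
  qed
  have "((\<lambda>\<Delta>. \<bar>(p \<Delta> - q \<Delta>) / \<Delta> - z\<bar>) \<longlongrightarrow> 0) (at_right 0)"
    using tendsto_rabs[OF tendsto_diff[OF lim tendsto_const[of z]]] by simp
  then show "((\<lambda>\<Delta>. hausdorff_dist (set_scale (inverse (e * \<Delta>)) (hukuhara_diff (P \<Delta>) (Q \<Delta>)))
      (cball 0 z)) \<longlongrightarrow> 0) (at_right 0)"
    by (rule Lim_null_comparison[OF bound])
qed

text \<open>On the level of support functions the Hukuhara difference is a subtraction. Evaluating
  at \<open>e *\<^sub>R p\<close> cancels the sign in the scaling factor because
  \<open>e * e = 1\<close>; what remains is the positive factor \<open>inverse \<Delta>\<close>,
  which positive homogeneity pulls out.\<close>

lemma hukuhara_lim_supp: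
  fixes P Q :: "real \<Rightarrow> 'a::euclidean_space set"
  assumes e: "e = 1 \<or> e = -1"
    and Kc: "\<forall>\<^sub>F \<Delta> in at_right 0. Q \<Delta> \<in> Kc"
    and lim: "hukuhara_lim (\<lambda>\<Delta>. inverse (e * \<Delta>)) P Q Z"
  shows "((\<lambda>\<Delta>. (supp (P \<Delta>) p - supp (Q \<Delta>) p) / \<Delta>) \<longlongrightarrow> supp Z (e *\<^sub>R p)) (at_right 0)"
proof -
  define W where "W \<Delta> = hukuhara_diff (P \<Delta>) (Q \<Delta>)" for \<Delta>
  have ex: "\<forall>\<^sub>F \<Delta> in at_right 0. \<exists>W. is_hukuhara_diff (P \<Delta>) (Q \<Delta>) W"
    and Z: "Z \<in> Kc"
    and lim': "((\<lambda>\<Delta>. hausdorff_dist (set_scale (inverse (e * \<Delta>)) (W \<Delta>)) Z) \<longlongrightarrow> 0) (at_right 0)"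
    using lim by (auto simp: hukuhara_lim_def W_def)
  have W: "\<forall>\<^sub>F \<Delta> in at_right 0. W \<Delta> \<in> Kc \<and> P \<Delta> = Q \<Delta> + W \<Delta> \<and> Q \<Delta> \<in> Kc"
    using ex Kc
  proof eventually_elim
    case (elim \<Delta>)
    then obtain V where V: "is_hukuhara_diff (P \<Delta>) (Q \<Delta>) V" by blast
    then have "W \<Delta> = V" unfolding W_def using elim hukuhara_diff_eq by blast
    then show ?case using V elim unfolding is_hukuhara_diff_def by blast
  qed
  have scaled: "\<forall>\<^sub>F \<Delta> in at_right 0. set_scale (inverse (e * \<Delta>)) (W \<Delta>) \<in> Kc"
    using W by eventually_elim
      (auto simp: Kc_def set_scale_def intro: compact_scaling convex_scaling)
  have pos: "\<forall>\<^sub>F \<Delta> in at_right (0::real). \<Delta> > 0" by (rule eventually_at_right_less)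
  have "\<forall>\<^sub>F \<Delta> in at_right 0. supp (set_scale (inverse (e * \<Delta>)) (W \<Delta>)) (e *\<^sub>R p)
      = (supp (P \<Delta>) p - supp (Q \<Delta>) p) / \<Delta>"
    using W pos
  proof eventually_elim
    case (elim \<Delta>)
    have  "supp (set_scale (inverse (e * \<Delta>)) (W \<Delta>)) (e *\<^sub>R p) = supp (W \<Delta>) (inverse \<Delta> *\<^sub>R p)"
      using e by (auto simp: supp_set_scale)
    also have "\<dots> = inverse \<Delta> * supp (W \<Delta>) p"
      using elim by (intro supp_scaleR Kc_D) auto
    also have "supp (W \<Delta>) p = supp (P \<Delta>) p - supp (Q \<Delta>) p"
      using elim supp_plus[of "Q \<Delta>" "W \<Delta>" p] by (metis Kc_D(1,2) add_diff_cancel_left')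
    finally show ?case by (simp add: divide_inverse mult.commute)
  qed
  from Lim_transform_eventually[OF tendsto_supp[OF scaled Z lim'] this] show ?thesis .
qed

subsection \<open>Aumann integrals\<close>

text \<open>The constant depends only on a ball containing the set, so one constant serves all
  \<open>X s\<close> while the direction \<open>p v* A s\<close> moves with
  \<open>s\<close>.\<close>

lemma supp_lipschitz:
  assumes X: "X \<noteq> {}" "X \<subseteq> cball 0 C"
  shows "\<bar>supp X p - supp X q\<bar> \<le> C * norm (p - q)"
proof -
  have b: "bounded X" using X(2) bounded_cball bounded_subset by blast
  have *: "supp X p \<le> supp X q + C * norm (p - q)" for p q
  proof (rule supp_le[OF X(1)])
    fix x assume x: "x \<in> X"
    have "p \<bullet> x = q \<bullet> x + (p - q) \<bullet> x" by (simp add: inner_diff_left)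
    also have "(p - q) \<bullet> x \<le> norm (p - q) * norm x" by (rule norm_cauchy_schwarz)
    also have "\<dots> \<le> norm (p - q) * C" using x X(2) by (intro mult_left_mono) auto
    finally show "p \<bullet> x \<le> supp X q + C * norm (p - q)"
      using inner_le_supp[OF b x, of q] by (simp add: mult.commute)
  qed
  show ?thesis using *[of p q] *[of q p] by (simp add: abs_le_iff norm_minus_commute)
qed

lemma set_continuous_on_subset: "set_continuous_on S X \<Longrightarrow> U \<subseteq> S \<Longrightarrow> set_continuous_on U X"
  unfolding set_continuous_on_def by (blast intro: tendsto_within_subset)

lemma continuous_on_supp_const:
  assumes "set_continuous_on S X" "\<And>t. t \<in> S \<Longrightarrow> X t \<in> Kc"
  shows "continuous_on S (\<lambda>t. supp (X t) p)"
  unfolding continuous_on_def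
proof
  fix t assume t: "t \<in> S"
  show "((\<lambda>t. supp (X t) p) \<longlongrightarrow> supp (X t) p) (at t within S)"
  proof (rule tendsto_supp)
    show "\<forall>\<^sub>F s in at t within S. X s \<in> Kc"
      using assms(2) by (auto simp: eventually_at_filter)
  qed (use assms t in \<open>auto simp: set_continuous_on_def\<close>)
qed

text \<open>The norms in \<open>X t\<close> are dominated by finitely many support values, which are
  continuous in \<open>t\<close> and hence bounded on the compact interval.\<close>

lemma set_continuous_on_bounded:
  assumes "set_continuous_on {a..b} X" "\<And>t. t \<in> {a..b} \<Longrightarrow> X t \<in> Kc"
  obtains C where "0 \<le> C" "\<And>t. t \<in> {a..b} \<Longrightarrow> X t \<subseteq> cball 0 C"
proof -
  let ?f = "\<lambda>t. \<Sum>b\<in>Basis. \<bar>supp (X t) b\<bar> + \<bar>supp (X t) (- b)\<bar>"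
  have "continuous_on {a..b} ?f"
    by (intro continuous_intros continuous_on_supp_const assms)
  then have "bounded (?f ` {a..b})"
    by (intro compact_imp_bounded compact_continuous_image) auto
  then obtain C where C: "C > 0" "\<And>t. t \<in> {a..b} \<Longrightarrow> norm (?f t) \<le> C"
    by (auto simp: bounded_pos)
  show thesis
  proof (rule that[of C])
    show "0 \<le> C" using C(1) by simp
    fix t assume t: "t \<in> {a..b}"
    show "X t \<subseteq> cball 0 C"
    proof
      fix x assume "x \<in> X t"
      then have "norm x \<le> ?f t"
        using assms(2)[OF t] by (intro norm_le_inner_bounds inner_le_supp Kc_D)
      with C(2)[OF t] show "x \<in> cball 0 C" by auto
    qed
  qed
qed

lemma continuous_on_supp:
  assumes X: "set_continuous_on {a..b} X" "\<And>t. t \<in> {a..b} \<Longrightarrow> X t \<in> Kc"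
    and p: "continuous_on {a..b} p"
  shows "continuous_on {a..b} (\<lambda>t. supp (X t) (p t))"
proof -
  obtain C where C: "0 \<le> C" "\<And>t. t \<in> {a..b} \<Longrightarrow> X t \<subseteq> cball 0 C"
    using set_continuous_on_bounded X by blast
  show ?thesis
    unfolding continuous_on_def
  proof
    fix t assume t: "t \<in> {a..b}"
    let ?F = "at t within {a..b}"
    have "((\<lambda>s. supp (X s) (p t)) \<longlongrightarrow> supp (X t) (p t)) ?F"
      using continuous_on_supp_const[OF X, of "p t"] t by (auto simp: continuous_on_def)
    moreover have "((\<lambda>s. supp (X s) (p s) - supp (X s) (p t)) \<longlongrightarrow> 0) ?F"
    proof (rule Lim_null_comparison)
      show "\<forall>\<^sub>F s in ?F. norm (supp (X s) (p s) - supp (X s) (p t)) \<le> C * norm (p s - p t)"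
        using supp_lipschitz[OF Kc_D(1)[OF X(2)] C(2)] by (simp add: eventually_at_filter)
      have "(p \<longlongrightarrow> p t) ?F" using p t by (auto simp: continuous_on_def)
      then show "((\<lambda>s. C * norm (p s - p t)) \<longlongrightarrow> 0) ?F"
        by (intro tendsto_mult_right_zero tendsto_norm_zero LIM_zero)
    qed
    ultimately show "((\<lambda>s. supp (X s) (p s)) \<longlongrightarrow> supp (X t) (p t)) ?F"
      by (rule Lim_transform)
  qed
qed

section \<open>Continuous selections by nearest points\<close>

text \<open>For the nearest points \<open>x\<close> and \<open>y\<close> the squared distance is
  \<open>(z - x) \<bullet> (y - x) + (z - y) \<bullet> (x - y)\<close>. Each summand would be
  nonpositive by the variational inequality if \<open>y\<close> lay in \<open>X\<close> and
  \<open>x\<close> in \<open>Y\<close>; replacing them by nearby points of the right set costs one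
  Hausdorff distance times \<open>norm z + C\<close>. So the projection depends on the set with
  Hoelder exponent 1/2.\<close>

lemma dist_closest_point_hausdorff:
  fixes X Y :: "'a::euclidean_space set"
  assumes X: "X \<in> Kc" "X \<subseteq> cball 0 C" and Y: "Y \<in> Kc" "Y \<subseteq> cball 0 C"
  shows "(dist (closest_point X z) (closest_point Y z))\<^sup>2 \<le> 2 * (norm z + C) * hausdorff_dist X Y"
proof -
  let ?x = "closest_point X z" and ?y = "closest_point Y z" and ?h = "hausdorff_dist X Y"
  have *: "(z - closest_point X z) \<bullet> (closest_point Y z - closest_point X z) \<le> (norm z + C) * hausdorff_dist X Y"
    if X: "X \<in> Kc" "X \<subseteq> cball 0 C" and Y: "Y \<in> Kc" for X Y :: "'a set"
  proof -
    let ?x = "closest_point X z" and ?y = "closest_point Y z" and ?h = "hausdorff_dist X Y"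
    have xy: "?x \<in> X" "?y \<in> Y" using X Y by (auto intro!: closest_point_in_set Kc_D)
    obtain w where w: "w \<in> X" "dist ?y w \<le> ?h"
      using hausdorff_dist_nearest[of Y X ?y] X Y xy Kc_D by (metis hausdorff_dist_commute)
    have "(z - ?x) \<bullet> (?y - ?x) = (z - ?x) \<bullet> (w - ?x) + (z - ?x) \<bullet> (?y - w)"
      by (simp add: algebra_simps)
    also have "(z - ?x) \<bullet> (w - ?x) \<le> 0"
      using X w by (intro closest_point_dot Kc_D)
    also have "(z - ?x) \<bullet> (?y - w) \<le> norm (z - ?x) * norm (?y - w)"
      by (rule norm_cauchy_schwarz)
    also have "\<dots> \<le> (norm z + C) * ?h"
    proof (rule mult_mono)
      show "norm (z - ?x) \<le> norm z + C"
        using xy X(2) norm_triangle_ineq4[of z ?x] by fastforce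
      then show "0 \<le> norm z + C" by (rule order_trans[OF norm_ge_zero])
    qed (use w in \<open>auto simp: dist_norm\<close>)
    finally show ?thesis by simp
  qed
  have "(dist ?x ?y)\<^sup>2 = (z - ?x) \<bullet> (?y - ?x) + (z - ?y) \<bullet> (?x - ?y)"
    by (simp add: dist_norm power2_norm_eq_inner algebra_simps inner_commute)
  with *[OF X Y(1)] *[OF Y X(1)] show ?thesis
    by (simp add: hausdorff_dist_commute[of Y X] algebra_simps)
qed

lemma continuous_on_closest_point_selector:
  assumes X: "set_continuous_on {a..b} X" "\<And>t. t \<in> {a..b} \<Longrightarrow> X t \<in> Kc"
    and z: "continuous_on {a..b} z"
  shows "continuous_on {a..b} (\<lambda>t. closest_point (X t) (z t))"
proof -
  obtain C where C: "0 \<le> C" "\<And>t. t \<in> {a..b} \<Longrightarrow> X t \<subseteq> cball 0 C"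
    using set_continuous_on_bounded X by blast
  show ?thesis
    unfolding continuous_on_def
  proof
    fix t assume t: "t \<in> {a..b}"
    let ?F = "at t within {a..b}" and ?c = "\<lambda>t. closest_point (X t)"
    \<comment> \<open>First term: projection onto the fixed set \<open>X s\<close> is 1-Lipschitz in
      the point. Second term: the same point projected onto two different sets.\<close>
    let ?d = "\<lambda>s. dist (z s) (z t) + sqrt (2 * (norm (z t) + C) * hausdorff_dist (X s) (X t))"
    have le: "dist (?c s (z s)) (?c t (z t)) \<le> ?d s" if s: "s \<in> {a..b}" for s
    proof -
      have "dist (?c s (z s)) (?c s (z t)) \<le> dist (z s) (z t)"
        using X(2)[OF s] by (intro closest_point_lipschitz Kc_D)
      moreover have "dist (?c s (z t)) (?c t (z t)) \<le> sqrt (2 * (norm (z t) + C) * hausdorff_dist (X s) (X t))"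
        using X(2) C(2) s t by (intro real_le_rsqrt dist_closest_point_hausdorff)
      ultimately show ?thesis using dist_triangle[of "?c s (z s)" "?c t (z t)" "?c s (z t)"] by linarith
    qed
    have "(z \<longlongrightarrow> z t) ?F" using z t by (auto simp: continuous_on_def)
    moreover have "((\<lambda>s. hausdorff_dist (X s) (X t)) \<longlongrightarrow> 0) ?F"
      using X(1) t by (auto simp: set_continuous_on_def)
    ultimately have "(?d \<longlongrightarrow> dist (z t) (z t) + sqrt (2 * (norm (z t) + C) * 0)) ?F"
      by (intro tendsto_intros)
    then have "(?d \<longlongrightarrow> 0) ?F" by simp
    moreover have "\<forall>\<^sub>F s in ?F. s \<in> {a..b}" by (simp add: eventually_at_filter)
    then have "\<forall>\<^sub>F s in ?F. norm (dist (?c s (z s)) (?c t (z t))) \<le> ?d s"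
      by eventually_elim (use le in simp)
    ultimately have "((\<lambda>s. dist (?c s (z s)) (?c t (z t))) \<longlongrightarrow> 0) ?F"
      by (rule Lim_null_comparison[rotated])
    then show "((\<lambda>s. ?c s (z s)) \<longlongrightarrow> ?c t (z t)) ?F"
      by (rule tendsto_dist_iff[THEN iffD2])
  qed
qed

text \<open>The nearest point to \<open>p / \<epsilon>\<close> maximises \<open>p \<bullet> x - \<epsilon> |x|\<^sup>2 / 2\<close>: it depends continuously on the
  set, which a maximiser of \<open>p \<bullet> x\<close> need not do.\<close>

lemma supp_le_closest_point:
  assumes X: "X \<in> Kc" "X \<subseteq> cball 0 C" and \<epsilon>: "0 < \<epsilon>"
  shows "supp X p \<le> p \<bullet> closest_point X (p /\<^sub>R \<epsilon>) + 2 * C\<^sup>2 * \<epsilon>"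
proof (rule supp_le[OF Kc_D(1)[OF X(1)]])
  fix y assume y: "y \<in> X"
  let ?x = "closest_point X (p /\<^sub>R \<epsilon>)"
  have x: "?x \<in> X" using X by (intro closest_point_in_set Kc_D)
  \<comment> \<open>The variational inequality at the nearest point; multiplied by
    \<open>\<epsilon>\<close> it compares \<open>p \<bullet> y\<close> with
    \<open>p \<bullet> ?x\<close> up to a multiple of \<open>\<epsilon>\<close>.\<close>
  have "(p /\<^sub>R \<epsilon> - ?x) \<bullet> (y - ?x) \<le> 0"
    using X y by (intro closest_point_dot Kc_D)
  then have "\<epsilon> * ((p /\<^sub>R \<epsilon> - ?x) \<bullet> (y - ?x)) \<le> 0"
    using \<epsilon> by (intro mult_nonneg_nonpos) auto
  also have "\<epsilon> * ((p /\<^sub>R \<epsilon> - ?x) \<bullet> (y - ?x)) = p \<bullet> y - p \<bullet> ?x - \<epsilon> * (?x \<bullet> (y - ?x))"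
    using \<epsilon> by (simp add: inner_diff_left inner_diff_right right_diff_distrib field_simps)
  finally have le: "p \<bullet> y \<le> p \<bullet> ?x + \<epsilon> * (?x \<bullet> (y - ?x))" by simp
  have "?x \<bullet> (y - ?x) \<le> norm ?x * norm (y - ?x)" by (rule norm_cauchy_schwarz)
  also have "\<dots> \<le> C * (2 * C)"
  proof (rule mult_mono)
    show x': "norm ?x \<le> C" using x X by auto
    then show "0 \<le> C" using norm_ge_zero order_trans by blast
    show "norm (y - ?x) \<le> 2 * C"
      using x' y X(2) norm_triangle_ineq4[of y ?x] by fastforce
  qed auto
  finally have "\<epsilon> * (?x \<bullet> (y - ?x)) \<le> \<epsilon> * (C * (2 * C))"
    using \<epsilon> by (intro mult_left_mono) auto
  with le show "p \<bullet> y \<le> p \<bullet> ?x + 2 * C\<^sup>2 * \<epsilon>" by (simp add: power2_eq_square algebra_simps)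
qed

lemma aumann_integralI:
  assumes "x absolutely_integrable_on {a..b}" "\<And>s. s \<in> {a..b} \<Longrightarrow> x s \<in> F s"
  shows "integral {a..b} x \<in> aumann_integral a b F"
  unfolding aumann_integral_def using assms by (intro CollectI exI[of _ x] conjI ballI refl)

lemma aumann_integralE:
  assumes "y \<in> aumann_integral a b F"
  obtains x where "x absolutely_integrable_on {a..b}" "\<And>s. s \<in> {a..b} \<Longrightarrow> x s \<in> F s"
    "y = integral {a..b} x"
proof -
  from assms[unfolded aumann_integral_def] show thesis
    by (elim CollectE exE conjE) (rule that, auto)
qed

text \<open>The upper bound integrates the pointwise inequality for a selector. For the lower bound,
  the nearest points to \<open>(p v* A s) /\<^sub>R \<epsilon>\<close> form a continuous selector
  that misses the pointwise supremum by at most \<open>2 * C\<^sup>2 * \<epsilon>\<close>, and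
  \<open>\<epsilon>\<close> is arbitrary. Together with nonemptiness and boundedness this is what
  additivity of \<open>supp\<close> asks for, so closedness and convexity of the integral never have
  to be established.\<close>

lemma
  fixes A :: "real \<Rightarrow> real^'n^'m" and X :: "real \<Rightarrow> (real^'n) set"
  assumes ab: "a \<le> b" and A: "continuous_on {a..b} A"
    and X: "set_continuous_on {a..b} X" "\<And>t. t \<in> {a..b} \<Longrightarrow> X t \<in> Kc"
  defines "I \<equiv> aumann_integral a b (\<lambda>s. set_mat_mult (A s) (X s))"
  shows supp_aumann_integral: "supp I p = integral {a..b} (\<lambda>s. supp (X s) (p v* A s))"
    and aumann_integral_nonempty: "I \<noteq> {}"
    and bounded_aumann_integral: "bounded I"
proof -
  obtain C where C: "0 \<le> C" "\<And>t. t \<in> {a..b} \<Longrightarrow> X t \<subseteq> cball 0 C"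
    using set_continuous_on_bounded X by blast
  let ?S = "\<lambda>p. integral {a..b} (\<lambda>s. supp (X s) (p v* A s))"
  have cont_pA: "continuous_on {a..b} (\<lambda>s. p v* A s)" for p
    unfolding vector_matrix_mult_def by (intro continuous_intros A)
  have int: "(\<lambda>s. supp (X s) (p v* A s)) integrable_on {a..b}" for p
    by (intro integrable_continuous_real continuous_on_supp X cont_pA)
  have le: "p \<bullet> y \<le> ?S p" if yI: "y \<in> I" for p y
  proof -
    obtain x where x: "x absolutely_integrable_on {a..b}" "\<And>s. s \<in> {a..b} \<Longrightarrow> x s \<in> set_mat_mult (A s) (X s)"
      and y: "y = integral {a..b} x"
      by (rule aumann_integralE[OF yI[unfolded I_def]]) (rule that, auto)
    have xi: "x integrable_on {a..b}" by (rule set_lebesgue_integral_eq_integral(1)[OF x(1)])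
    have "((\<lambda>s. p \<bullet> x s) has_integral p \<bullet> y) {a..b}"
      using has_integral_linear[OF integrable_integral[OF xi] bounded_linear_inner_right[of p]]
      by (simp add: o_def y)
    then show ?thesis
    proof (rule has_integral_le[OF _ integrable_integral[OF int]])
      fix s assume s: "s \<in> {a..b}"
      obtain w where "w \<in> X s" "x s = A s *v w"
        using x(2)[OF s] by (auto simp: set_mat_mult_def)
      then show "p \<bullet> x s \<le> supp (X s) (p v* A s)"
        using X(2)[OF s] inner_le_supp[of "X s" w "p v* A s"] by (simp add: dot_lmul_matrix Kc_D)
    qed
  qed
  have sel: "\<exists>y\<in>I. ?S p - 2 * C\<^sup>2 * \<epsilon> * (b - a) \<le> p \<bullet> y" if \<epsilon>: "0 < \<epsilon>" for \<epsilon> p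
  proof -
    define w where "w s = closest_point (X s) ((p v* A s) /\<^sub>R \<epsilon>)" for s
    have w: "continuous_on {a..b} w"
      unfolding w_def by (intro continuous_on_closest_point_selector continuous_intros cont_pA X)
    have cont: "continuous_on {a..b} (\<lambda>s. A s *v w s)"
      unfolding matrix_vector_mult_def by (intro continuous_intros A w)
    then have hi: "((\<lambda>s. p \<bullet> (A s *v w s)) has_integral p \<bullet> integral {a..b} (\<lambda>s. A s *v w s)) {a..b}"
      using has_integral_linear[OF integrable_integral[OF integrable_continuous_real] bounded_linear_inner_right]
      by (simp add: o_def)
    have "((\<lambda>s. supp (X s) (p v* A s) - 2 * C\<^sup>2 * \<epsilon>) has_integral ?S p - 2 * C\<^sup>2 * \<epsilon> * (b - a)) {a..b}"
      using has_integral_diff[OF integrable_integral[OF int] has_integral_const_real[of "2 * C\<^sup>2 * \<epsilon>" a b]] ab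
      by (simp add: mult.commute)
    then have "?S p - 2 * C\<^sup>2 * \<epsilon> * (b - a) \<le> p \<bullet> integral {a..b} (\<lambda>s. A s *v w s)"
    proof (rule has_integral_le[OF _ hi])
      fix s assume s: "s \<in> {a..b}"
      show "supp (X s) (p v* A s) - 2 * C\<^sup>2 * \<epsilon> \<le> p \<bullet> (A s *v w s)"
        using supp_le_closest_point[OF X(2)[OF s] C(2)[OF s] \<epsilon>, of "p v* A s"]
        by (simp add: w_def dot_lmul_matrix)
    qed
    moreover have "integral {a..b} (\<lambda>s. A s *v w s) \<in> I"
    proof -
      have "A s *v w s \<in> set_mat_mult (A s) (X s)" if "s \<in> {a..b}" for s
        unfolding set_mat_mult_def w_def
        using X(2)[OF that] by (intro imageI closest_point_in_set Kc_D)
      moreover have "(\<lambda>s. A s *v w s) absolutely_integrable_on {a..b}"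
        by (rule absolutely_integrable_continuous_real[OF cont])
      ultimately show ?thesis unfolding I_def by (intro aumann_integralI)
    qed
    ultimately show ?thesis by blast
  qed
  show ne: "I \<noteq> {}" using sel[of 1] by auto
  have "norm y \<le> (\<Sum>b\<in>Basis. \<bar>?S b\<bar> + \<bar>?S (- b)\<bar>)" if "y \<in> I" for y
    using le[OF that] by (rule norm_le_inner_bounds)
  then show bd: "bounded I" by (rule boundedI)
  show "supp I p = ?S p"
  proof (rule antisym)
    show "supp I p \<le> ?S p" using le by (intro supp_le ne)
    let ?K = "2 * C\<^sup>2 * (b - a)"
    have "?S p \<le> supp I p + e" if e: "0 < e" for e
    proof -
      have K: "0 \<le> ?K" using ab by simp
      then have K1: "0 < ?K + 1" by linarith
      \<comment> \<open>Adding 1 keeps the denominator positive when \<open>?K\<close> vanishes, as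
        for \<open>a = b\<close> or \<open>C = 0\<close>.\<close>
      with e have "0 < e / (?K + 1)" by (rule divide_pos_pos)
      from sel[OF this, of p] obtain y where "y \<in> I" "?S p - ?K * (e / (?K + 1)) \<le> p \<bullet> y"
        by (auto simp: mult_ac)
      moreover have "?K * (e / (?K + 1)) \<le> e"
        using e K1 by (subst times_divide_eq_right, subst pos_divide_le_eq) (simp_all add: algebra_simps)
      ultimately show ?thesis using inner_le_supp[OF bd, of y p] by linarith
    qed
    then show "?S p \<le> supp I p" by (rule field_le_epsilon)
  qed
qed

lemma aumann_integral_cball:
  assumes ab: "a \<le> b" and f: "continuous_on {a..b} f" "\<And>s. s \<in> {a..b} \<Longrightarrow> 0 \<le> f s"
  shows "aumann_integral a b (\<lambda>s. cball (0::'a::euclidean_space) (f s)) = cball 0 (integral {a..b} f)"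
proof
  have fi: "f integrable_on {a..b}" by (rule integrable_continuous_real[OF f(1)])
  show "aumann_integral a b (\<lambda>s. cball (0::'a) (f s)) \<subseteq> cball 0 (integral {a..b} f)"
    unfolding aumann_integral_def
    by (auto intro!: integral_norm_bound_integral fi dest: set_lebesgue_integral_eq_integral(1))
  show "cball 0 (integral {a..b} f) \<subseteq> aumann_integral a b (\<lambda>s. cball (0::'a) (f s))"
  proof
    fix y :: 'a assume y: "y \<in> cball 0 (integral {a..b} f)"
    let ?\<rho> = "integral {a..b} f"
    \<comment> \<open>A fixed vector of norm at most 1, scaled by the radius at time
      \<open>s\<close>. If \<open>?\<rho>\<close> is 0 then \<open>y\<close> is 0 too, and
      \<open>inverse 0 = 0\<close> makes this the zero selector.\<close>
    let ?x = "\<lambda>s. f s *\<^sub>R (y /\<^sub>R ?\<rho>)"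
    have \<rho>: "0 \<le> ?\<rho>" using f by (intro integral_nonneg fi)
    have "integral {a..b} ?x = ?\<rho> *\<^sub>R (y /\<^sub>R ?\<rho>)"
      by (rule integral_unique) (intro has_integral_scaleR_left integrable_integral fi)
    also have "\<dots> = y" using y by (cases "?\<rho> = 0") auto
    finally have y_eq: "integral {a..b} ?x = y" .
    have "?x absolutely_integrable_on {a..b}"
      by (intro absolutely_integrable_continuous_real continuous_intros f)
    moreover have "norm (y /\<^sub>R ?\<rho>) \<le> 1" using y \<rho> by (cases "?\<rho> = 0") (auto simp: field_simps)
    then have "?x s \<in> cball 0 (f s)" if "s \<in> {a..b}" for s
      using mult_left_mono[OF _ f(2)[OF that], of "norm (y /\<^sub>R ?\<rho>)" 1] f(2)[OF that]
      by (simp add: abs_mult mult.assoc)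
    ultimately have "integral {a..b} ?x \<in> aumann_integral a b (\<lambda>s. cball 0 (f s))"
      by (intro aumann_integralI)
    then show "y \<in> aumann_integral a b (\<lambda>s. cball 0 (f s))"
      by (simp only: y_eq)
  qed
qed

subsection \<open>Uniqueness\<close>

lemma abs_le_of_deriv_le:
  fixes f g :: "real \<Rightarrow> real"
  assumes ab: "a \<le> b" and cont: "continuous_on {a..b} f" "continuous_on {a..b} g"
    and f: "\<And>t. t \<in> {a<..<b} \<Longrightarrow> (f has_real_derivative f' t) (at t)"
    and g: "\<And>t. t \<in> {a<..<b} \<Longrightarrow> (g has_real_derivative g' t) (at t)"
    and le: "\<And>t. t \<in> {a<..<b} \<Longrightarrow> \<bar>f' t\<bar> \<le> g' t"
  shows "\<bar>f b - f a\<bar> \<le> g b - g a"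
proof -
  have "f b - g b \<le> f a - g a"
  proof (rule DERIV_nonpos_imp_decreasing_open[OF ab])
    show "\<exists>y. ((\<lambda>t. f t - g t) has_real_derivative y) (at t) \<and> y \<le> 0" if "a < t" "t < b" for t
      using that le[of t]
      by (intro exI[of _ "f' t - g' t"] conjI DERIV_diff f g) auto
  qed (intro continuous_intros cont)
  moreover have "- f b - g b \<le> - f a - g a"
  proof (rule DERIV_nonpos_imp_decreasing_open[OF ab])
    show "\<exists>y. ((\<lambda>t. - f t - g t) has_real_derivative y) (at t) \<and> y \<le> 0" if "a < t" "t < b" for t
      using that le[of t]
      by (intro exI[of _ "- f' t - g' t"] conjI DERIV_diff DERIV_minus f g) auto
  qed (intro continuous_intros cont)
  ultimately show ?thesis by linarith
qed

text \<open>A Gronwall argument by Picard iteration: it needs no regularity of \<open>t \<mapsto> sup |u t|\<close>.\<close>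

lemma iterated_deriv_bound_imp_zero:
  fixes u :: "real \<Rightarrow> 'a::real_normed_vector \<Rightarrow> real" and L :: "real \<Rightarrow> 'a \<Rightarrow> 'a"
  assumes K: "0 \<le> K" "\<And>t p. t \<in> {a<..<b} \<Longrightarrow> norm (L t p) \<le> K * norm p"
    and C: "\<And>t p. t \<in> {a..b} \<Longrightarrow> \<bar>u t p\<bar> \<le> C * norm p"
    and init: "\<And>p. u a p = 0"
    and cont: "\<And>p. continuous_on {a..b} (\<lambda>t. u t p)"
    and deriv: "\<And>t p. t \<in> {a<..<b} \<Longrightarrow> ((\<lambda>t. u t p) has_real_derivative D t p) (at t)"
    and D: "\<And>t p. t \<in> {a<..<b} \<Longrightarrow> \<bar>D t p\<bar> \<le> \<bar>u t (L t p)\<bar>"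
    and C0: "0 \<le> C" and t: "t \<in> {a..b}"
  shows "u t p = 0"
proof -
  have bound: "\<bar>u t p\<bar> \<le> C * (K * (t - a)) ^ n / fact n * norm p" if "t \<in> {a..b}" for n t p
    using that
  proof (induction n arbitrary: t p)
    case 0
    then show ?case using C by simp
  next
    case (Suc n)
    \<comment> \<open>The induction hypothesis is applied at the new direction \<open>L s p\<close>,
      whose norm is at most \<open>K * norm p\<close>; this bound is exactly \<open>?g'\<close>, the
      derivative of \<open>?g\<close>. Integrating raises the power and completes the
      factorial.\<close>
    let ?g = "\<lambda>t. C * (K * (t - a)) ^ Suc n / fact (Suc n) * norm p"
    let ?g' = "\<lambda>t. C * (K * (t - a)) ^ n / fact n * (K * norm p)"
    have "\<bar>u t p - u a p\<bar> \<le> ?g t - ?g a"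
    proof (rule abs_le_of_deriv_le)
      show "continuous_on {a..t} (\<lambda>t. u t p)"
        using Suc.prems by (intro continuous_on_subset[OF cont]) auto
      show "continuous_on {a..t} ?g" by (intro continuous_intros) auto
      fix s assume "s \<in> {a<..<t}"
      then have s: "s \<in> {a<..<b}" using Suc.prems by auto
      show "((\<lambda>t. u t p) has_real_derivative D s p) (at s)" by (rule deriv[OF s])
      have "((\<lambda>t. K * (t - a)) has_real_derivative K) (at s)"
        by (auto intro!: derivative_eq_intros)
      from DERIV_power_Suc[OF this, of n]
      have "((\<lambda>t. (K * (t - a)) ^ Suc n) has_real_derivative real (Suc n) * (K * (s - a)) ^ n * K) (at s)"
        by (simp add: mult_ac)
      then have "((\<lambda>t. (C / fact (Suc n) * norm p) * (K * (t - a)) ^ Suc n) has_real_derivative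
          (C / fact (Suc n) * norm p) * (real (Suc n) * (K * (s - a)) ^ n * K)) (at s)"
        by (rule DERIV_cmult)
      moreover have "(C / fact (Suc n) * norm p) * (real (Suc n) * (K * (s - a)) ^ n * K) = ?g' s"
        by (simp add: fact_Suc field_simps del: of_nat_Suc)
      ultimately show "(?g has_real_derivative ?g' s) (at s)" by (simp add: mult_ac)
      have "\<bar>D s p\<bar> \<le> \<bar>u s (L s p)\<bar>" by (rule D[OF s])
      also have "\<dots> \<le> C * (K * (s - a)) ^ n / fact n * norm (L s p)"
        using s by (intro Suc.IH) auto
      also have "\<dots> \<le> ?g' s"
        using s K C0 by (intro mult_left_mono K divide_nonneg_nonneg mult_nonneg_nonneg) auto
      finally show "\<bar>D s p\<bar> \<le> ?g' s" .
    qed (use Suc.prems in auto)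
    then show ?case by (simp add: init)
  qed
  \<comment> \<open>The bounds are terms of a convergent exponential series, up to the constant
    \<open>C * norm p\<close>.\<close>
  have "(\<lambda>n. inverse (fact n) * (K * (t - a)) ^ n) \<longlonglongrightarrow> 0"
    by (rule summable_LIMSEQ_zero[OF summable_exp])
  then have "(\<lambda>n. C * norm p * (inverse (fact n) * (K * (t - a)) ^ n)) \<longlonglongrightarrow> 0"
    by (rule tendsto_mult_right_zero)
  moreover have "\<bar>u t p\<bar> \<le> C * norm p * (inverse (fact n) * (K * (t - a)) ^ n)" for n
    using bound[OF t, of p n] by (simp add: divide_inverse mult_ac)
  ultimately have "\<bar>u t p\<bar> \<le> 0"
    by (intro LIMSEQ_le_const) auto
  then show ?thesis by simp
qed

text \<open>The differential equation in terms of support functions. The signs are \<open>e1 = 1\<close> for option (i)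
  and \<open>e1 = -1\<close> for option (ii); \<open>e2 = -1\<close> only for option (ii) of the BG-derivative, which reflects
  the right-hand side.\<close>

definition supp_ode ::
  "real \<Rightarrow> real \<Rightarrow> (real \<Rightarrow> real^'n^'n) \<Rightarrow> (real \<Rightarrow> real) \<Rightarrow> real \<Rightarrow> real \<Rightarrow> (real \<Rightarrow> (real^'n) set) \<Rightarrow> bool" where
  "supp_ode e1 e2 A r a b X \<longleftrightarrow>
     (\<forall>t\<in>{a..b}. X t \<in> Kc) \<and> set_continuous_on {a..b} X \<and> (\<forall>p. supp (X a) p = norm p) \<and>
     (\<forall>p. \<forall>t\<in>{a<..<b}. ((\<lambda>s. supp (X s) p) has_real_derivative
        e1 * (supp (X t) ((e2 *\<^sub>R p) v* A t) + r t * norm p)) (at t))"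

lemma bounded_vector_matrix_mult:
  fixes A :: "real \<Rightarrow> real^'n^'m"
  assumes "continuous_on {a..b} A"
  obtains K where "0 \<le> K" "\<And>t p. t \<in> {a..b} \<Longrightarrow> norm (p v* A t) \<le> K * norm p"
proof -
  have "continuous_on {a..b} (\<lambda>t. \<Sum>i\<in>UNIV. norm (A t $ i))"
    by (intro continuous_intros assms)
  then have "bounded ((\<lambda>t. \<Sum>i\<in>UNIV. norm (A t $ i)) ` {a..b})"
    by (intro compact_imp_bounded compact_continuous_image) auto
  then obtain K where K: "K > 0" "\<And>t. t \<in> {a..b} \<Longrightarrow> norm (\<Sum>i\<in>UNIV. norm (A t $ i)) \<le> K"
    by (auto simp: bounded_pos)
  show thesis
  proof (rule that[of K])
    fix t p assume t: "t \<in> {a..b}"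
    have "p v* A t = (\<Sum>i\<in>UNIV. (p $ i) *\<^sub>R (A t $ i))"
      by (simp add: vec_eq_iff vector_matrix_mult_def mult.commute)
    then have "norm (p v* A t) \<le> (\<Sum>i\<in>UNIV. \<bar>p $ i\<bar> * norm (A t $ i))"
      using norm_sum[of "\<lambda>i. (p $ i) *\<^sub>R (A t $ i)" UNIV] by simp
    also have "\<dots> \<le> (\<Sum>i\<in>UNIV. norm p * norm (A t $ i))"
      by (intro sum_mono mult_right_mono component_le_norm_cart) auto
    also have "\<dots> \<le> norm p * K"
      using K(2)[OF t] by (auto simp: sum_distrib_left[symmetric] intro!: mult_left_mono)
    finally show "norm (p v* A t) \<le> K * norm p" by (simp add: mult.commute)
  qed (use K in simp)
qed

text \<open>In the difference of the two equations the term \<open>r t * norm p\<close> and the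
  initial value cancel, and the signs have modulus 1. The rest is the homogeneous bound treated by
  the iteration, with the a priori constant \<open>C + C'\<close> from boundedness of both
  maps.\<close>

lemma supp_ode_unique:
  fixes A :: "real \<Rightarrow> real^'n^'n"
  assumes A: "continuous_on {a..b} A" and e: "\<bar>e1\<bar> = 1" "\<bar>e2\<bar> = 1"
    and X: "supp_ode e1 e2 A r a b X" and Y: "supp_ode e1 e2 A r a b Y"
    and t: "t \<in> {a..b}"
  shows "X t = Y t"
proof (rule supp_inject)
  show "X t \<in> Kc" "Y t \<in> Kc" using X Y t by (auto simp: supp_ode_def)
  obtain K where K: "0 \<le> K" "\<And>t p. t \<in> {a..b} \<Longrightarrow> norm (p v* A t) \<le> K * norm p"
    using bounded_vector_matrix_mult[OF A] by blast
  have Kc: "\<And>t. t \<in> {a..b} \<Longrightarrow> X t \<in> Kc" "\<And>t. t \<in> {a..b} \<Longrightarrow> Y t \<in> Kc"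
    and co: "set_continuous_on {a..b} X" "set_continuous_on {a..b} Y"
    and d: "\<And>p t. t \<in> {a<..<b} \<Longrightarrow> ((\<lambda>s. supp (X s) p) has_real_derivative
        e1 * (supp (X t) ((e2 *\<^sub>R p) v* A t) + r t * norm p)) (at t)"
      "\<And>p t. t \<in> {a<..<b} \<Longrightarrow> ((\<lambda>s. supp (Y s) p) has_real_derivative
        e1 * (supp (Y t) ((e2 *\<^sub>R p) v* A t) + r t * norm p)) (at t)"
    and init: "\<And>p. supp (X a) p = norm p" "\<And>p. supp (Y a) p = norm p"
    using X Y by (auto simp: supp_ode_def)
  obtain C where C: "0 \<le> C" "\<And>t. t \<in> {a..b} \<Longrightarrow> X t \<subseteq> cball 0 C"
    using set_continuous_on_bounded[OF co(1) Kc(1)] by blast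
  obtain C' where C': "0 \<le> C'" "\<And>t. t \<in> {a..b} \<Longrightarrow> Y t \<subseteq> cball 0 C'"
    using set_continuous_on_bounded[OF co(2) Kc(2)] by blast
  fix p
  have "supp (X t) p - supp (Y t) p = 0"
  proof (rule iterated_deriv_bound_imp_zero[where L = "\<lambda>t p. (e2 *\<^sub>R p) v* A t" and C = "C + C'" and
        u = "\<lambda>t p. supp (X t) p - supp (Y t) p", OF K(1) _ _ _ _ DERIV_diff[OF d]])
    show "norm ((e2 *\<^sub>R p) v* A t) \<le> K * norm p" if "t \<in> {a<..<b}" for t p
      using K(2)[of t "e2 *\<^sub>R p"] that e by simp
    show "\<bar>supp (X t) p - supp (Y t) p\<bar> \<le> (C + C') * norm p" if "t \<in> {a..b}" for t p
      using abs_supp_le[OF Kc_D(1)[OF Kc(1)] C(2), OF that that, of p]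
        abs_supp_le[OF Kc_D(1)[OF Kc(2)] C'(2), OF that that, of p]
      by (simp add: distrib_right)
    show "continuous_on {a..b} (\<lambda>t. supp (X t) p - supp (Y t) p)" for p
      by (intro continuous_intros continuous_on_supp_const co Kc)
    show "\<bar>e1 * (supp (X t) ((e2 *\<^sub>R p) v* A t) + r t * norm p) -
        e1 * (supp (Y t) ((e2 *\<^sub>R p) v* A t) + r t * norm p)\<bar>
      \<le> \<bar>supp (X t) ((e2 *\<^sub>R p) v* A t) - supp (Y t) ((e2 *\<^sub>R p) v* A t)\<bar>" for t p
      using e by (simp add: abs_mult flip: right_diff_distrib)
  qed (use C C' init t in auto)
  then show "supp (X t) p = supp (Y t) p" by simp
qed

section \<open>From set derivatives to derivatives of support functions\<close>

lemma has_real_derivative_two_sided: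
  fixes f :: "real \<Rightarrow> real"
  assumes "((\<lambda>h. (f (t + h) - f t) / h) \<longlongrightarrow> D) (at_right 0)"
    and "((\<lambda>h. (f t - f (t - h)) / h) \<longlongrightarrow> D) (at_right 0)"
  shows "(f has_real_derivative D) (at t)"
  unfolding DERIV_def
proof (rule filterlim_split_at)
  have "(f (t + - h) - f t) / - h = (f t - f (t - h)) / h" for h
    by (simp add: divide_simps)
  with assms(2) show "((\<lambda>h. (f (t + h) - f t) / h) \<longlongrightarrow> D) (at_left 0)"
    by (simp add: filterlim_at_left_to_right)
qed (rule assms(1))

lemma supp_rhs:
  fixes A :: "real^'n^'n"
  assumes "X \<in> Kc" "0 \<le> \<rho>"
  shows "supp (set_mat_mult A X + cball 0 \<rho>) p = supp X (p v* A) + \<rho> * norm p"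
proof -
  have "bounded (set_mat_mult A X)"
    unfolding set_mat_mult_def
    by (intro bounded_linear_image Kc_D assms matrix_vector_mul_bounded_linear)
  moreover have "set_mat_mult A X \<noteq> {}" using assms by (auto simp: set_mat_mult_def Kc_def)
  ultimately show ?thesis
    using assms by (subst supp_plus) (auto simp: supp_set_mat_mult supp_cball)
qed

lemma eventually_shift_interval:
  fixes t :: real
  assumes t: "a < t" "t < b"
  shows "\<forall>\<^sub>F \<Delta> in at_right 0. 0 < \<Delta> \<and> t - \<Delta> \<in> {a..b} \<and> t + \<Delta> \<in> {a..b}"
proof -
  have "\<forall>\<^sub>F \<Delta> in at_right 0. \<Delta> < min (t - a) (b - t)"
    using t by (intro order_tendstoD(2)[OF tendsto_ident_at]) auto
  moreover have "\<forall>\<^sub>F \<Delta> in at_right (0::real). 0 < \<Delta>" by (rule eventually_at_right_less)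
  ultimately show ?thesis by eventually_elim auto
qed

lemma eventually_shift_Kc:
  fixes X :: "real \<Rightarrow> 'a::euclidean_space set"
  assumes Kc: "\<And>s. s \<in> {a..b} \<Longrightarrow> X s \<in> Kc" and t: "a < t" "t < b"
  shows "\<forall>\<^sub>F \<Delta> in at_right 0. X t \<in> Kc" "\<forall>\<^sub>F \<Delta> in at_right 0. X (t + \<Delta>) \<in> Kc"
    "\<forall>\<^sub>F \<Delta> in at_right 0. X (t - \<Delta>) \<in> Kc"
proof -
  show "\<forall>\<^sub>F \<Delta> in at_right 0. X t \<in> Kc" using Kc t by simp
  have "\<forall>\<^sub>F \<Delta> in at_right 0. X (t + \<Delta>) \<in> Kc \<and> X (t - \<Delta>) \<in> Kc"
    using eventually_shift_interval[OF t] by eventually_elim (use Kc in auto)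
  then show "\<forall>\<^sub>F \<Delta> in at_right 0. X (t + \<Delta>) \<in> Kc" "\<forall>\<^sub>F \<Delta> in at_right 0. X (t - \<Delta>) \<in> Kc"
    by (auto elim: eventually_mono)
qed

text \<open>The sign of the scaling factor in option (ii), and also the factor in front of the
  Aumann integral in the corresponding integral equation.\<close>

fun kind_sign :: "deriv_kind \<Rightarrow> real" where
  "kind_sign BG = -1"
| "kind_sign PS = 1"

lemma kind_sign: "kind_sign k = 1 \<or> kind_sign k = -1" "\<bar>kind_sign k\<bar> = 1"
  by (cases k; simp)+

text \<open>The factor \<open>1 * \<Delta>\<close> is left unsimplified to match
  \<open>inverse (e * \<Delta>)\<close> in the results on Hukuhara limits.\<close>

lemma has_derivative_case_i:
  "has_derivative_case k Case_i X t Z \<longleftrightarrow>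
     hukuhara_lim (\<lambda>\<Delta>. inverse (1 * \<Delta>)) (\<lambda>\<Delta>. X (t + \<Delta>)) (\<lambda>_. X t) Z \<and>
     hukuhara_lim (\<lambda>\<Delta>. inverse (1 * \<Delta>)) (\<lambda>_. X t) (\<lambda>\<Delta>. X (t - \<Delta>)) Z"
  by (cases k) (simp_all add: has_hukuhara_derivative_def)

lemma has_derivative_case_ii:
  "has_derivative_case k Case_ii X t Z \<longleftrightarrow>
     hukuhara_lim (\<lambda>\<Delta>. inverse (kind_sign k * \<Delta>)) (\<lambda>_. X t) (\<lambda>\<Delta>. X (t + \<Delta>)) Z \<and>
     hukuhara_lim (\<lambda>\<Delta>. inverse (kind_sign k * \<Delta>)) (\<lambda>\<Delta>. X (t - \<Delta>)) (\<lambda>_. X t) Z"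
  by (cases k) simp_all

lemma has_derivative_case_i_supp:
  fixes X :: "real \<Rightarrow> 'a::euclidean_space set"
  assumes Kc: "\<And>s. s \<in> {a..b} \<Longrightarrow> X s \<in> Kc" and t: "a < t" "t < b"
    and D: "has_derivative_case k Case_i X t Z"
  shows "((\<lambda>s. supp (X s) p) has_real_derivative supp Z p) (at t)"
proof (rule has_real_derivative_two_sided)
  note ev = eventually_shift_Kc[of a b X t, OF Kc t]
  show "((\<lambda>h. (supp (X (t + h)) p - supp (X t) p) / h) \<longlongrightarrow> supp Z p) (at_right 0)"
    using hukuhara_lim_supp[of 1, OF _ ev(1)] D by (simp add: has_derivative_case_i)
  show "((\<lambda>h. (supp (X t) p - supp (X (t - h)) p) / h) \<longlongrightarrow> supp Z p) (at_right 0)"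
    using hukuhara_lim_supp[of 1, OF _ ev(3)] D by (simp add: has_derivative_case_i)
qed

text \<open>The differences of option (ii) run backwards in time, which gives the outer minus sign;
  the sign of the scaling factor appears separately, as a reflection of the direction.\<close>

lemma has_derivative_case_ii_supp:
  fixes X :: "real \<Rightarrow> 'a::euclidean_space set"
  assumes Kc: "\<And>s. s \<in> {a..b} \<Longrightarrow> X s \<in> Kc" and t: "a < t" "t < b"
    and D: "has_derivative_case k Case_ii X t Z"
  shows "((\<lambda>s. supp (X s) p) has_real_derivative - supp Z (kind_sign k *\<^sub>R p)) (at t)"
proof (rule has_real_derivative_two_sided)
  note ev = eventually_shift_Kc[of a b X t, OF Kc t]
  have "((\<lambda>h. - ((supp (X t) p - supp (X (t + h)) p) / h)) \<longlongrightarrow> - supp Z (kind_sign k *\<^sub>R p)) (at_right 0)"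
    using hukuhara_lim_supp[OF kind_sign(1) ev(2)] D
    by (intro tendsto_minus) (simp add: has_derivative_case_ii)
  then show "((\<lambda>h. (supp (X (t + h)) p - supp (X t) p) / h) \<longlongrightarrow> - supp Z (kind_sign k *\<^sub>R p)) (at_right 0)"
    by (simp add: minus_divide_left)
  have "((\<lambda>h. - ((supp (X (t - h)) p - supp (X t) p) / h)) \<longlongrightarrow> - supp Z (kind_sign k *\<^sub>R p)) (at_right 0)"
    using hukuhara_lim_supp[OF kind_sign(1) ev(1)] D
    by (intro tendsto_minus) (simp add: has_derivative_case_ii)
  then show "((\<lambda>h. (supp (X t) p - supp (X (t - h)) p) / h) \<longlongrightarrow> - supp Z (kind_sign k *\<^sub>R p)) (at_right 0)"
    by (simp add: minus_divide_left)
qed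

lemma admissible_mapD:
  assumes "admissible_map t0 t1 T X"
  shows "t0 < t1" "t1 < T" "\<And>t. t \<in> {t0..T} \<Longrightarrow> X t \<in> Kc" "\<And>t. t \<in> {t0..t1} \<Longrightarrow> X t \<in> Kc"
    "set_continuous_on {t0..t1} X"
  using assms by (auto simp: admissible_map_def elim: set_continuous_on_subset)

lemma diff_solution_i_supp_ode:
  assumes r: "\<And>t. 0 \<le> r t" and X: "diff_solution (has_derivative_case k Case_i) A r t0 t1 T X"
  shows "supp_ode 1 1 A r t0 t1 X"
proof -
  have adm: "admissible_map t0 t1 T X" using X by (simp add: diff_solution_def)
  note adm = admissible_mapD[OF adm]
  have "((\<lambda>s. supp (X s) p) has_real_derivative supp (X t) (p v* A t) + r t * norm p) (at t)"
    if "t \<in> {t0<..<t1}" for t p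
    using has_derivative_case_i_supp[where X = X and a = t0 and b = T and k = k and t = t and p = p
        and Z = "set_mat_mult (A t) (X t) + cball 0 (r t)", OF adm(3)]
      X that adm(2) adm(3)[of t] by (auto simp: diff_solution_def supp_rhs r)
  with adm X show ?thesis by (auto simp: supp_ode_def diff_solution_def supp_cball)
qed

lemma diff_solution_ii_supp_ode:
  assumes r: "\<And>t. 0 \<le> r t" and X: "diff_solution (has_derivative_case k Case_ii) A r t0 t1 T X"
  shows "supp_ode (-1) (kind_sign k) A r t0 t1 X"
proof -
  have adm: "admissible_map t0 t1 T X" using X by (simp add: diff_solution_def)
  note adm = admissible_mapD[OF adm]
  have "((\<lambda>s. supp (X s) p) has_real_derivative
      - (supp (X t) ((kind_sign k *\<^sub>R p) v* A t) + r t * norm p)) (at t)"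
    if "t \<in> {t0<..<t1}" for t p
    using has_derivative_case_ii_supp[where X = X and a = t0 and b = T and k = k and t = t and p = p
        and Z = "set_mat_mult (A t) (X t) + cball 0 (r t)", OF adm(3)]
      X that adm(2) adm(3)[of t] kind_sign(2)[of k] by (auto simp: diff_solution_def supp_rhs r)
  with adm X show ?thesis by (auto simp: supp_ode_def diff_solution_def supp_cball)
qed

section \<open>From integral equations to derivatives of support functions\<close>

text \<open>The integrands are continuous in time, so the right-hand side is differentiable by the
  fundamental theorem of calculus; at \<open>t = a\<close> both integrals vanish and leave the
  initial value.\<close>

lemma integral_eq_supp_ode:
  fixes A :: "real \<Rightarrow> real^'n^'n"
  assumes A: "continuous_on {a..b} A" and r: "continuous_on {a..b} r"
    and Kc: "\<And>t. t \<in> {a..b} \<Longrightarrow> X t \<in> Kc" and co: "set_continuous_on {a..b} X"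
    and ab: "a \<le> b"
    and eq: "\<And>t p. t \<in> {a..b} \<Longrightarrow> supp (X t) p = norm p +
        e1 * (integral {a..t} (\<lambda>s. supp (X s) ((e2 *\<^sub>R p) v* A s)) + integral {a..t} r * norm p)"
  shows "supp_ode e1 e2 A r a b X"
  unfolding supp_ode_def
proof (intro conjI allI ballI)
  fix p t assume t: "t \<in> {a<..<b}"
  have "continuous_on {a..b} (\<lambda>s. (e2 *\<^sub>R p) v* A s)"
    unfolding vector_matrix_mult_def by (intro continuous_intros A)
  then have F: "continuous_on {a..b} (\<lambda>s. supp (X s) ((e2 *\<^sub>R p) v* A s))"
    by (intro continuous_on_supp co Kc)
  have "((\<lambda>t. norm p + e1 * (integral {a..t} (\<lambda>s. supp (X s) ((e2 *\<^sub>R p) v* A s)) + integral {a..t} r * norm p))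
      has_real_derivative 0 + e1 * (supp (X t) ((e2 *\<^sub>R p) v* A t) + r t * norm p)) (at t within {a..b})"
    using t by (intro DERIV_add DERIV_const DERIV_cmult DERIV_cmult_right integral_has_real_derivative F r) auto
  then have "((\<lambda>s. supp (X s) p) has_real_derivative
      0 + e1 * (supp (X t) ((e2 *\<^sub>R p) v* A t) + r t * norm p)) (at t within {a..b})"
    by (rule has_field_derivative_transform_within[OF _ zero_less_one]) (use t eq in auto)
  moreover have "at t within {a..b} = at t" using t by (intro at_within_interior) auto
  ultimately show "((\<lambda>s. supp (X s) p) has_real_derivative
      e1 * (supp (X t) ((e2 *\<^sub>R p) v* A t) + r t * norm p)) (at t)"
    by simp
next
  fix p show "supp (X a) p = norm p" using eq[of a p] ab by simp
qed (use Kc co in auto)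

lemma int_solution_i_supp_ode:
  assumes A: "continuous_on {t0..t1} A" and r: "continuous_on {t0..t1} r" "\<And>t. 0 \<le> r t"
    and X: "int_solution_i A r t0 t1 T X"
  shows "supp_ode 1 1 A r t0 t1 X"
proof -
  have adm: "admissible_map t0 t1 T X" using X by (simp add: int_solution_i_def)
  note adm = admissible_mapD[OF adm]
  show ?thesis
  proof (rule integral_eq_supp_ode[OF A r(1) adm(4,5)])
    fix t p assume t: "t \<in> {t0..t1}"
    let ?I = "aumann_integral t0 t (\<lambda>s. set_mat_mult (A s) (X s))"
    have sub: "{t0..t} \<subseteq> {t0..t1}" "t0 \<le> t" using t by auto
    note I = sub(2) continuous_on_subset[OF A sub(1)] set_continuous_on_subset[OF adm(5) sub(1)] adm(4)
    have "0 \<le> integral {t0..t} r"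
      by (intro integral_nonneg integrable_continuous_real continuous_on_subset[OF r(1) sub(1)]) (use r in auto)
    moreover have "supp ?I p = integral {t0..t} (\<lambda>s. supp (X s) (p v* A s))"
      using sub by (intro supp_aumann_integral I) auto
    moreover have "?I \<noteq> {}" "bounded ?I"
      using sub by (intro aumann_integral_nonempty bounded_aumann_integral I; auto)+
    moreover have "X t = cball 0 1 + ?I + cball 0 (integral {t0..t} r)"
      using X t by (auto simp: int_solution_i_def)
    ultimately show "supp (X t) p = norm p +
        1 * (integral {t0..t} (\<lambda>s. supp (X s) ((1 *\<^sub>R p) v* A s)) + integral {t0..t} r * norm p)"
      by (simp add: supp_plus set_plus_nonempty bounded_set_plus supp_cball)
  qed (use adm in auto)
qed

lemma int_solution_ii_iff:
  "int_solution_ii k A r t0 t1 T X \<longleftrightarrow>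
     admissible_map t0 t1 T X \<and>
     (\<forall>t\<in>{t0..t1}.
        X t + set_scale (kind_sign k) (aumann_integral t0 t (\<lambda>s. set_mat_mult (A s) (X s)))
          + cball 0 (integral {t0..t} r) = cball 0 1)"
  by (cases k) (simp_all add: set_scale_def)

text \<open>Here \<open>X t\<close> is only one summand of a known ball. Once support functions are
  taken, the other summands can simply be moved across, which yields the sign
  \<open>-1\<close>.\<close>

lemma int_solution_ii_supp_ode:
  assumes A: "continuous_on {t0..t1} A" and r: "continuous_on {t0..t1} r" "\<And>t. 0 \<le> r t"
    and X: "int_solution_ii k A r t0 t1 T X"
  shows "supp_ode (-1) (kind_sign k) A r t0 t1 X"
proof -
  have adm: "admissible_map t0 t1 T X" using X by (simp add: int_solution_ii_iff)
  note adm = admissible_mapD[OF adm]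
  show ?thesis
  proof (rule integral_eq_supp_ode[OF A r(1) adm(4,5)])
    fix t p assume t: "t \<in> {t0..t1}"
    let ?e = "kind_sign k" and ?I = "aumann_integral t0 t (\<lambda>s. set_mat_mult (A s) (X s))"
    have sub: "{t0..t} \<subseteq> {t0..t1}" "t0 \<le> t" using t by auto
    note I = sub(2) continuous_on_subset[OF A sub(1)] set_continuous_on_subset[OF adm(5) sub(1)] adm(4)
    have R: "0 \<le> integral {t0..t} r"
      by (intro integral_nonneg integrable_continuous_real continuous_on_subset[OF r(1) sub(1)]) (use r in auto)
    have I_supp: "supp ?I (?e *\<^sub>R p) = integral {t0..t} (\<lambda>s. supp (X s) ((?e *\<^sub>R p) v* A s))"
      using sub by (intro supp_aumann_integral I) auto
    have "?I \<noteq> {}" "bounded ?I"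
      using sub by (intro aumann_integral_nonempty bounded_aumann_integral I; auto)+
    then have I': "set_scale ?e ?I \<noteq> {}" "bounded (set_scale ?e ?I)"
      by (auto simp: set_scale_def bounded_scaling)
    have "X t + set_scale ?e ?I + cball 0 (integral {t0..t} r) = cball 0 1"
      using X t by (auto simp: int_solution_ii_iff)
    then have "supp (X t + set_scale ?e ?I + cball 0 (integral {t0..t} r)) p = supp (cball 0 1) p"
      by simp
    then have "supp (X t) p + supp ?I (?e *\<^sub>R p) + integral {t0..t} r * norm p = norm p"
      using I' R adm(4)[OF t]
      by (simp add: supp_plus set_plus_nonempty bounded_set_plus supp_cball supp_set_scale Kc_D)
    then show "supp (X t) p = norm p +
        (-1) * (integral {t0..t} (\<lambda>s. supp (X s) ((?e *\<^sub>R p) v* A s)) + integral {t0..t} r * norm p)"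
      by (simp add: I_supp)
  qed (use adm in auto)
qed

subsection \<open>Existence\<close>

lemma mat_vector_mult: "mat c *v x = c *\<^sub>R (x :: real^'n)"
  by (simp add: vec_eq_iff matrix_vector_mult_def mat_def if_distrib if_distribR cong: if_cong)

text \<open>For the symmetric matrix \<open>B\<close>, a double root makes the discriminant of the
  characteristic polynomial vanish. That discriminant is a sum of two squares, so the diagonal
  entries agree and the off-diagonal entry is 0. The determinant formula later yields continuity and
  positivity of \<open>\<sigma>\<close>, which is given only pointwise through singular
  values.\<close>

lemma equal_singular_values:
  fixes A :: "real^2^2"
  assumes sv: "singular_values A (vector [\<sigma>, \<sigma>])"
  shows "transpose A ** A = mat (\<sigma>\<^sup>2)" and "\<sigma> = sqrt \<bar>det A\<bar>"
proof -
  define B where "B = transpose A ** A"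
  have sym: "B $ 1 $ 2 = B $ 2 $ 1"
    by (simp add: B_def matrix_matrix_mult_def transpose_def mult.commute)
  have \<sigma>: "0 \<le> \<sigma>" using sv by (auto simp: singular_values_def forall_2)
  have "det (mat x - B) = (\<Prod>i\<in>UNIV. x - ((vector [\<sigma>, \<sigma>] :: real^2) $ i)\<^sup>2)" for x
    using sv unfolding singular_values_def B_def by blast
  then have char: "(x - B $ 1 $ 1) * (x - B $ 2 $ 2) - B $ 1 $ 2 * B $ 1 $ 2 = (x - \<sigma>\<^sup>2) * (x - \<sigma>\<^sup>2)" for x
    by (simp add: det_2 UNIV_2 mat_def sym)
  \<comment> \<open>The constant coefficient is read off at \<open>x = 0\<close>; the trace then
    follows from \<open>x = 1\<close>.\<close>
  have c0: "B $ 1 $ 1 * B $ 2 $ 2 - B $ 1 $ 2 * B $ 1 $ 2 = \<sigma>\<^sup>2 * \<sigma>\<^sup>2" using char[of 0] by simp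
  have tr: "B $ 1 $ 1 + B $ 2 $ 2 = 2 * \<sigma>\<^sup>2" using char[of 1] c0 by (simp add: algebra_simps)
  have "(B $ 1 $ 1 - B $ 2 $ 2)\<^sup>2 + 4 * (B $ 1 $ 2)\<^sup>2
      = (B $ 1 $ 1 + B $ 2 $ 2)\<^sup>2 - 4 * (B $ 1 $ 1 * B $ 2 $ 2 - B $ 1 $ 2 * B $ 1 $ 2)"
    by (simp add: power2_eq_square algebra_simps)
  also have "\<dots> = 0" by (simp add: tr c0 power2_eq_square)
  finally have disc: "(B $ 1 $ 1 - B $ 2 $ 2)\<^sup>2 + 4 * (B $ 1 $ 2)\<^sup>2 = 0" .
  then have "(B $ 1 $ 1 - B $ 2 $ 2)\<^sup>2 = 0" "(B $ 1 $ 2)\<^sup>2 = 0"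
    using zero_le_power2[of "B $ 1 $ 1 - B $ 2 $ 2"] zero_le_power2[of "B $ 1 $ 2"] by linarith+
  then have "B $ 1 $ 1 = B $ 2 $ 2" "B $ 1 $ 2 = 0" by simp_all
  with tr sym show "transpose A ** A = mat (\<sigma>\<^sup>2)"
    by (simp add: vec_eq_iff forall_2 mat_def flip: B_def)
  have "\<bar>det A\<bar>\<^sup>2 = det B" by (simp add: B_def det_mul power2_eq_square)
  also have "\<dots> = (\<sigma>\<^sup>2)\<^sup>2" using c0 by (simp add: det_2 sym power2_eq_square)
  finally have "\<bar>det A\<bar> = \<sigma>\<^sup>2" by (rule power2_eq_imp_eq) simp_all
  then show "\<sigma> = sqrt \<bar>det A\<bar>" using \<sigma> by simp
qed

text \<open>\<open>A\<close> multiplies every norm by \<open>\<sigma>\<close>, which gives one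
  inclusion. For the other, \<open>inverse (\<sigma>\<^sup>2) *\<^sub>R transpose A\<close> is a
  left inverse, hence a right inverse of the square matrix, and the preimage has the right
  norm.\<close>

lemma set_mat_mult_cball:
  fixes A :: "real^'n^'n"
  assumes A: "transpose A ** A = mat (\<sigma>\<^sup>2)" and \<sigma>: "0 < \<sigma>"
  shows "set_mat_mult A (cball 0 \<rho>) = cball 0 (\<sigma> * \<rho>)"
proof
  have norm: "norm (A *v x) = \<sigma> * norm x" for x
  proof -
    have "(A *v x) \<bullet> (A *v x) = ((transpose A ** A) *v x) \<bullet> x"
      by (simp add: dot_lmul_matrix flip: matrix_vector_mul_assoc)
    also have "\<dots> = \<sigma>\<^sup>2 * (x \<bullet> x)" by (simp only: A mat_vector_mult inner_scaleR_left)
    finally have "(norm (A *v x))\<^sup>2 = (\<sigma> * norm x)\<^sup>2"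
      by (simp add: power2_norm_eq_inner power_mult_distrib)
    then show ?thesis using \<sigma> by (simp add: power2_eq_iff_nonneg)
  qed
  show "set_mat_mult A (cball 0 \<rho>) \<subseteq> cball 0 (\<sigma> * \<rho>)"
    using \<sigma> by (auto simp: set_mat_mult_def norm)
  have "(inverse (\<sigma>\<^sup>2) *\<^sub>R transpose A) ** A = mat 1"
    using \<sigma> by (simp add: scalar_matrix_assoc[symmetric] A) (simp add: vec_eq_iff mat_def)
  then have inv: "A ** (inverse (\<sigma>\<^sup>2) *\<^sub>R transpose A) = mat 1"
    by (simp add: matrix_left_right_inverse)
  show "cball 0 (\<sigma> * \<rho>) \<subseteq> set_mat_mult A (cball 0 \<rho>)"
  proof
    fix y :: "real^'n" assume y: "y \<in> cball 0 (\<sigma> * \<rho>)"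
    let ?x = "(inverse (\<sigma>\<^sup>2) *\<^sub>R transpose A) *v y"
    have Ax: "A *v ?x = y"
      using inv by (metis matrix_vector_mul_assoc matrix_vector_mul_lid)
    then have "\<sigma> * norm ?x \<le> \<sigma> * \<rho>" using y norm[of ?x] by simp
    then have "?x \<in> cball 0 \<rho>" using \<sigma> by simp
    with Ax show "y \<in> set_mat_mult A (cball 0 \<rho>)"
      unfolding set_mat_mult_def by (metis imageI)
  qed
qed

section \<open>Set derivatives of ball-valued maps\<close>

lemma has_real_derivative_imp_two_sided:
  fixes f :: "real \<Rightarrow> real"
  assumes "(f has_real_derivative D) (at t)"
  shows "((\<lambda>h. (f (t + h) - f t) / h) \<longlongrightarrow> D) (at_right 0)"
    and "((\<lambda>h. (f t - f (t - h)) / h) \<longlongrightarrow> D) (at_right 0)"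
proof -
  have lim: "((\<lambda>h. (f (t + h) - f t) / h) \<longlongrightarrow> D) (at 0)" using assms by (simp add: DERIV_def)
  then show "((\<lambda>h. (f (t + h) - f t) / h) \<longlongrightarrow> D) (at_right 0)"
    by (rule filterlim_mono) (auto simp: at_le)
  have "((\<lambda>h. (f (t + h) - f t) / h) \<longlongrightarrow> D) (at_left 0)"
    using lim by (rule filterlim_mono) (auto simp: at_le)
  moreover have "(f (t + - h) - f t) / - h = (f t - f (t - h)) / h" for h
    by (simp add: divide_simps)
  ultimately show "((\<lambda>h. (f t - f (t - h)) / h) \<longlongrightarrow> D) (at_right 0)"
    by (simp add: filterlim_at_left_to_right)
qed

text \<open>Monotonicity orders the radii near \<open>t\<close>, so that the Hukuhara differences
  exist; the sign of the derivative at \<open>t\<close> alone would not do so when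
  \<open>z = 0\<close>.\<close>

lemma has_derivative_case_i_cball:
  fixes X :: "real \<Rightarrow> 'a::euclidean_space set"
  assumes X: "\<And>s. s \<in> {a..b} \<Longrightarrow> X s = cball 0 (g s)" and g: "\<And>s. s \<in> {a..b} \<Longrightarrow> 0 \<le> g s"
    and mono: "mono_on {a..b} g" and t: "a < t" "t < b"
    and deriv: "(g has_real_derivative z) (at t)" and z: "0 \<le> z"
  shows "has_derivative_case k Case_i X t (cball 0 z)"
  unfolding has_derivative_case_i
proof
  note ev = eventually_shift_interval[OF t] and lim = has_real_derivative_imp_two_sided[OF deriv]
  show "hukuhara_lim (\<lambda>\<Delta>. inverse (1 * \<Delta>)) (\<lambda>\<Delta>. X (t + \<Delta>)) (\<lambda>_. X t) (cball 0 z)"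
    by (rule hukuhara_lim_cball[OF _ eventually_mono[OF ev] lim(1) z])
      (use X g t in \<open>auto intro!: mono_onD[OF mono]\<close>)
  show "hukuhara_lim (\<lambda>\<Delta>. inverse (1 * \<Delta>)) (\<lambda>_. X t) (\<lambda>\<Delta>. X (t - \<Delta>)) (cball 0 z)"
    by (rule hukuhara_lim_cball[OF _ eventually_mono[OF ev] lim(2) z])
      (use X g t in \<open>auto intro!: mono_onD[OF mono]\<close>)
qed

lemma has_derivative_case_ii_cball:
  fixes X :: "real \<Rightarrow> 'a::euclidean_space set"
  assumes X: "\<And>s. s \<in> {a..b} \<Longrightarrow> X s = cball 0 (g s)" and g: "\<And>s. s \<in> {a..b} \<Longrightarrow> 0 \<le> g s"
    and anti: "antimono_on {a..b} g" and t: "a < t" "t < b"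
    and deriv: "(g has_real_derivative - z) (at t)" and z: "0 \<le> z"
  shows "has_derivative_case k Case_ii X t (cball 0 z)"
  unfolding has_derivative_case_ii
proof
  have "((\<lambda>s. - g s) has_real_derivative z) (at t)" using DERIV_minus[OF deriv] by simp
  then have lim: "((\<lambda>\<Delta>. (g t - g (t + \<Delta>)) / \<Delta>) \<longlongrightarrow> z) (at_right 0)"
      "((\<lambda>\<Delta>. (g (t - \<Delta>) - g t) / \<Delta>) \<longlongrightarrow> z) (at_right 0)"
    using has_real_derivative_imp_two_sided by fastforce+
  note ev = eventually_shift_interval[OF t]
  show "hukuhara_lim (\<lambda>\<Delta>. inverse (kind_sign k * \<Delta>)) (\<lambda>_. X t) (\<lambda>\<Delta>. X (t + \<Delta>)) (cball 0 z)"
    by (rule hukuhara_lim_cball[OF kind_sign(2) eventually_mono[OF ev] lim(1) z])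
      (use X g t in \<open>auto intro!: monotone_onD[OF anti]\<close>)
  show "hukuhara_lim (\<lambda>\<Delta>. inverse (kind_sign k * \<Delta>)) (\<lambda>\<Delta>. X (t - \<Delta>)) (\<lambda>_. X t) (cball 0 z)"
    by (rule hukuhara_lim_cball[OF kind_sign(2) eventually_mono[OF ev] lim(2) z])
      (use X g t in \<open>auto intro!: monotone_onD[OF anti]\<close>)
qed

lemma aumann_integral_cong:
  assumes "\<And>s. s \<in> {a..b} \<Longrightarrow> F s = F' s"
  shows "aumann_integral a b F = aumann_integral a b F'"
  using assms unfolding aumann_integral_def by (metis (no_types, lifting))

lemma admissible_map_cball:
  assumes t: "t0 < t1" "t1 < T" and X: "\<And>s. s \<in> {t0..T} \<Longrightarrow> X s = cball 0 (g s)"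
    and g: "\<And>s. s \<in> {t0..T} \<Longrightarrow> 0 \<le> g s" "continuous_on {t0..T} g"
  shows "admissible_map t0 t1 T X"
proof -
  have "set_continuous_on {t0..T} X"
    unfolding set_continuous_on_def
  proof
    fix t assume t: "t \<in> {t0..T}"
    let ?F = "at t within {t0..T}"
    have "(g \<longlongrightarrow> g t) ?F" using g(2) t by (auto simp: continuous_on_def)
    then have lim: "((\<lambda>s. \<bar>g s - g t\<bar>) \<longlongrightarrow> 0) ?F"
      by (intro tendsto_rabs_zero LIM_zero)
    have "\<forall>\<^sub>F s in ?F. s \<in> {t0..T}" by (simp add: eventually_at_filter)
    then have "\<forall>\<^sub>F s in ?F. norm (hausdorff_dist (X s) (X t)) \<le> \<bar>g s - g t\<bar>"
    proof eventually_elim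
      case (elim s)
      note Xg = X[OF elim] X[OF t] and pos = g(1)[OF elim] g(1)[OF t]
      have "0 \<le> hausdorff_dist (X s) (X t)"
        using pos by (intro hausdorff_dist_nonneg) (simp_all add: Xg)
      then show ?case using hausdorff_dist_cball_le[OF pos] by (simp add: Xg)
    qed
    from Lim_null_comparison[OF this lim]
    show "((\<lambda>s. hausdorff_dist (X s) (X t)) \<longlongrightarrow> 0) ?F" .
  qed
  with t X g show ?thesis by (auto simp: admissible_map_def cball_Kc)
qed

text \<open>The two basic solutions are treated together: \<open>e = 1\<close> gives the radius of the first one and
  \<open>e = -1\<close> that of the second one.\<close>

definition ball_radius :: "real \<Rightarrow> (real \<Rightarrow> real) \<Rightarrow> (real \<Rightarrow> real) \<Rightarrow> real \<Rightarrow> real \<Rightarrow> real" where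
  "ball_radius e \<sigma> r t0 t =
     exp (e * integral {t0..t} \<sigma>) + e * integral {t0..t} (\<lambda>s. exp (e * integral {s..t} \<sigma>) * r s)"

text \<open>Variation of constants: splitting the exponent at \<open>s\<close> pulls the factor
  depending on \<open>t\<close> out of the integral, so that the fundamental theorem of calculus
  applies to what is left. The second factor also exhibits the sign of the radius.\<close>

lemma ball_radius_eq:
  assumes \<sigma>: "continuous_on {t0..} \<sigma>"
  shows "ball_radius e \<sigma> r t0 t =
    exp (e * integral {t0..t} \<sigma>) * (1 + e * integral {t0..t} (\<lambda>s. exp (- e * integral {t0..s} \<sigma>) * r s))"
proof -
  have "exp (e * integral {s..t} \<sigma>) * r s
      = exp (e * integral {t0..t} \<sigma>) * (exp (- e * integral {t0..s} \<sigma>) * r s)" if s: "s \<in> {t0..t}" for s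
  proof -
    have "\<sigma> integrable_on {t0..t}"
      by (intro integrable_continuous_real continuous_on_subset[OF \<sigma>]) auto
    then have "integral {t0..t} \<sigma> = integral {t0..s} \<sigma> + integral {s..t} \<sigma>"
      using s Henstock_Kurzweil_Integration.integral_combine[of t0 s t \<sigma>] by auto
    then show ?thesis by (simp add: algebra_simps flip: exp_add)
  qed
  then have "integral {t0..t} (\<lambda>s. exp (e * integral {s..t} \<sigma>) * r s)
      = integral {t0..t} (\<lambda>s. exp (e * integral {t0..t} \<sigma>) * (exp (- e * integral {t0..s} \<sigma>) * r s))"
    by (rule integral_cong)
  also have "\<dots> = exp (e * integral {t0..t} \<sigma>) * integral {t0..t} (\<lambda>s. exp (- e * integral {t0..s} \<sigma>) * r s)"
    by (rule integral_mult_right)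
  finally show ?thesis by (simp add: ball_radius_def distrib_left mult.left_commute)
qed

lemma ball_radius_deriv:
  assumes \<sigma>: "continuous_on {t0..} \<sigma>" and r: "continuous_on {t0..} r"
    and e: "\<bar>e\<bar> = 1" and t: "t \<in> {t0..T}"
  shows "(ball_radius e \<sigma> r t0 has_real_derivative e * (\<sigma> t * ball_radius e \<sigma> r t0 t + r t)) (at t within {t0..T})"
proof -
  let ?\<Sigma> = "\<lambda>t. integral {t0..t} \<sigma>" and ?F = "at t within {t0..T}"
  let ?\<phi> = "\<lambda>t. integral {t0..t} (\<lambda>s. exp (- e * ?\<Sigma> s) * r s)"
  have co: "continuous_on {t0..T} \<sigma>" "continuous_on {t0..T} r"
    by (auto intro: continuous_on_subset[OF \<sigma>] continuous_on_subset[OF r])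
  have \<Sigma>: "(?\<Sigma> has_real_derivative \<sigma> t) (at t within {t0..T})" if "t \<in> {t0..T}" for t
    by (rule integral_has_real_derivative[OF co(1) that])
  then have "continuous_on {t0..T} ?\<Sigma>"
    by (meson DERIV_continuous_on)
  then have "(?\<phi> has_real_derivative exp (- e * ?\<Sigma> t) * r t) ?F"
    by (intro integral_has_real_derivative t continuous_intros co)
  then have "((\<lambda>t. exp (e * ?\<Sigma> t) * (1 + e * ?\<phi> t)) has_real_derivative
      exp (e * ?\<Sigma> t) * (e * \<sigma> t) * (1 + e * ?\<phi> t) + e * (exp (- e * ?\<Sigma> t) * r t) * exp (e * ?\<Sigma> t)) ?F"
    using \<Sigma>[OF t] by (auto intro!: derivative_eq_intros)
  \<comment> \<open>In the product rule this cancellation leaves \<open>e * r t\<close>, the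
    inhomogeneous term.\<close>
  moreover have "exp (- e * ?\<Sigma> t) * exp (e * ?\<Sigma> t) = 1" by (simp flip: exp_add)
  then have "e * (exp (- e * ?\<Sigma> t) * r t) * exp (e * ?\<Sigma> t) = e * r t" by simp
  then have "exp (e * ?\<Sigma> t) * (e * \<sigma> t) * (1 + e * ?\<phi> t) + e * (exp (- e * ?\<Sigma> t) * r t) * exp (e * ?\<Sigma> t)
      = e * (\<sigma> t * (exp (e * ?\<Sigma> t) * (1 + e * ?\<phi> t)) + r t)"
    by (simp only:) (simp add: algebra_simps)
  ultimately show ?thesis
    unfolding ball_radius_eq[OF \<sigma>] ball_radius_eq[OF \<sigma>, abs_def] by (simp only:)
qed

lemma has_real_derivative_interior:
  fixes f :: "real \<Rightarrow> real"
  assumes "(f has_real_derivative D) (at t within {a..b})" "a < t" "t < b"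
  shows "(f has_real_derivative D) (at t)"
  using assms at_within_interior[of t "{a..b}"] by simp

lemma diameter_monotone_cball:
  assumes "\<And>s. s \<in> S \<Longrightarrow> X s = cball (0::'a::euclidean_space) (g s)" "\<And>s. s \<in> S \<Longrightarrow> 0 \<le> g s"
  shows "mono_on S g \<Longrightarrow> mono_on S (\<lambda>t. diameter (X t))"
    and "antimono_on S g \<Longrightarrow> antimono_on S (\<lambda>t. diameter (X t))"
proof -
  have "diameter (X s) = 2 * g s" if "s \<in> S" for s
    using assms(2)[OF that] by (simp add: assms(1)[OF that])
  then show "mono_on S g \<Longrightarrow> mono_on S (\<lambda>t. diameter (X t))"
    "antimono_on S g \<Longrightarrow> antimono_on S (\<lambda>t. diameter (X t))"
    by (simp_all add: monotone_on_def)
qed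

lemma monotone_on_of_deriv:
  fixes g :: "real \<Rightarrow> real"
  assumes d: "\<And>t. t \<in> {a..b} \<Longrightarrow> (g has_real_derivative D t) (at t within {a..b})"
  shows "(\<And>t. t \<in> {a..b} \<Longrightarrow> 0 \<le> D t) \<Longrightarrow> mono_on {a..b} g"
    and "(\<And>t. t \<in> {a..b} \<Longrightarrow> D t \<le> 0) \<Longrightarrow> antimono_on {a..b} g"
proof -
  have co: "continuous_on {x..y} g" if "a \<le> x" "y \<le> b" for x y
    by (rule continuous_on_subset[OF DERIV_continuous_on[OF d]]) (use that in auto)
  have d': "(g has_real_derivative D t) (at t)" if "a \<le> x" "y \<le> b" "x < t" "t < y" for t x y
    using that by (intro has_real_derivative_interior[OF d]) auto
  show "mono_on {a..b} g" if "\<And>t. t \<in> {a..b} \<Longrightarrow> 0 \<le> D t"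
  proof (rule mono_onI)
    fix x y assume xy: "x \<in> {a..b}" "y \<in> {a..b}" "x \<le> y"
    show "g x \<le> g y"
    proof (rule DERIV_nonneg_imp_increasing_open[OF xy(3)])
      show "\<exists>z. (g has_real_derivative z) (at t) \<and> 0 \<le> z" if "x < t" "t < y" for t
        using xy that d'[of x y t] \<open>\<And>t. t \<in> {a..b} \<Longrightarrow> 0 \<le> D t\<close>[of t] by auto
    qed (use xy co in auto)
  qed
  show "antimono_on {a..b} g" if "\<And>t. t \<in> {a..b} \<Longrightarrow> D t \<le> 0"
  proof (rule monotone_onI)
    fix x y assume xy: "x \<in> {a..b}" "y \<in> {a..b}" "x \<le> y"
    show "g y \<le> g x"
    proof (rule DERIV_nonpos_imp_decreasing_open[OF xy(3)])
      show "\<exists>z. (g has_real_derivative z) (at t) \<and> z \<le> 0" if "x < t" "t < y" for t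
        using xy that d'[of x y t] \<open>\<And>t. t \<in> {a..b} \<Longrightarrow> D t \<le> 0\<close>[of t] by auto
    qed (use xy co in auto)
  qed
qed

lemma has_set_derivative_diff_solution:
  "diff_solution (has_derivative_case k j) A r t0 t1 T X \<Longrightarrow>
   diff_solution (has_set_derivative k) A r t0 t1 T X"
  by (auto simp: diff_solution_def has_set_derivative_def)

text \<open>Balls add and scale by their radii, so each set equation becomes the scalar one for
  \<open>g\<close>. The data range over \<open>{t0..T}\<close> because the equation is also required
  at \<open>t1\<close>, where a two-sided derivative needs room to the right.\<close>

lemma
  fixes A :: "real \<Rightarrow> real^2^2" and g \<sigma> r :: "real \<Rightarrow> real"
  assumes t01: "t0 < t1" "t1 < T"
    and A: "\<And>t \<rho>. t \<in> {t0..T} \<Longrightarrow> set_mat_mult (A t) (cball 0 \<rho>) = cball 0 (\<sigma> t * \<rho>)"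
    and \<sigma>: "continuous_on {t0..T} \<sigma>" "\<And>t. t \<in> {t0..T} \<Longrightarrow> 0 < \<sigma> t"
    and r: "continuous_on {t0..T} r" "\<And>t. 0 \<le> r t"
    and g: "g t0 = 1" "\<And>t. t \<in> {t0..T} \<Longrightarrow> 0 \<le> g t"
    and X: "\<And>t. t \<in> {t0..T} \<Longrightarrow> X t = cball 0 (g t)"
  shows first_basic_solution_cball:
    "(\<And>t. t \<in> {t0..T} \<Longrightarrow> (g has_real_derivative \<sigma> t * g t + r t) (at t within {t0..T}))
     \<Longrightarrow> first_basic_solution k A r t0 t1 T X"
    and second_basic_solution_cball:
    "(\<And>t. t \<in> {t0..T} \<Longrightarrow> (g has_real_derivative - (\<sigma> t * g t + r t)) (at t within {t0..T}))
     \<Longrightarrow> second_basic_solution k A r t0 t1 T X"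
proof -
  have z: "0 \<le> \<sigma> t * g t" "0 \<le> \<sigma> t * g t + r t" if "t \<in> {t0..T}" for t
    using \<sigma>(2)[OF that] g(2)[OF that] r(2)[of t] by auto
  have rhs: "set_mat_mult (A t) (X t) + cball 0 (r t) = cball 0 (\<sigma> t * g t + r t)" if "t \<in> {t0..T}" for t
    using that z(1)[OF that] by (simp add: X A set_plus_cball r)
  have X0: "X t0 = cball 0 1" using t01 g X by simp
  have R: "0 \<le> integral {t0..t} r" "r integrable_on {t0..t}" if "t \<in> {t0..T}" for t
  proof -
    show "r integrable_on {t0..t}"
      using that by (intro integrable_continuous_real continuous_on_subset[OF r(1)]) auto
    then show "0 \<le> integral {t0..t} r" by (rule integral_nonneg) (rule r)
  qed
  have int: "aumann_integral t0 t (\<lambda>s. set_mat_mult (A s) (X s)) = cball 0 (integral {t0..t} (\<lambda>s. \<sigma> s * g s))"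
      (is "?A")
    and int_nonneg: "0 \<le> integral {t0..t} (\<lambda>s. \<sigma> s * g s)" (is "?N")
    and int_add: "integral {t0..t} (\<lambda>s. \<sigma> s * g s + r s) = integral {t0..t} (\<lambda>s. \<sigma> s * g s) + integral {t0..t} r" (is "?P")
    if co: "continuous_on {t0..T} g" and t: "t \<in> {t0..T}" for t
  proof -
    have co_\<sigma>g: "continuous_on {t0..t} (\<lambda>s. \<sigma> s * g s)"
      using t by (intro continuous_intros continuous_on_subset[OF \<sigma>(1)] continuous_on_subset[OF co]) auto
    have "aumann_integral t0 t (\<lambda>s. set_mat_mult (A s) (X s)) = aumann_integral t0 t (\<lambda>s. cball 0 (\<sigma> s * g s))"
      using t by (intro aumann_integral_cong) (auto simp: X A)
    also have "\<dots> = cball 0 (integral {t0..t} (\<lambda>s. \<sigma> s * g s))"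
      using t z(1) by (intro aumann_integral_cball co_\<sigma>g) auto
    finally show ?A .
    show ?N using t z(1) by (intro integral_nonneg integrable_continuous_real co_\<sigma>g) auto
    show ?P by (intro Henstock_Kurzweil_Integration.integral_add integrable_continuous_real[OF co_\<sigma>g] R(2)[OF t])
  qed
  \<comment> \<open>The integrated radius equation, which is the scalar form of both integral
    equations; the 1 is \<open>g t0\<close>.\<close>
  have FTC: "integral {t0..t} D = g t - 1"
    if d: "\<And>t. t \<in> {t0..T} \<Longrightarrow> (g has_real_derivative D t) (at t within {t0..T})" and t: "t \<in> {t0..T}" for D t
  proof -
    have "(D has_integral (g t - g t0)) {t0..t}"
    proof (rule fundamental_theorem_of_calculus)
      fix s assume "s \<in> {t0..t}"
      with t have "(g has_real_derivative D s) (at s within {t0..t})"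
        by (intro DERIV_subset[OF d[of s]]) auto
      then show "(g has_vector_derivative D s) (at s within {t0..t})"
        by (simp add: has_real_derivative_iff_has_vector_derivative)
    qed (use t in auto)
    then show ?thesis using g(1) by (simp add: integral_unique)
  qed
  have sub: "{t0..t1} \<subseteq> {t0..T}" using t01 by auto
  show "first_basic_solution k A r t0 t1 T X"
    if d: "\<And>t. t \<in> {t0..T} \<Longrightarrow> (g has_real_derivative \<sigma> t * g t + r t) (at t within {t0..T})"
  proof -
    have co: "continuous_on {t0..T} g" by (rule DERIV_continuous_on[OF d])
    have mono: "mono_on {t0..T} g" using d z(2) by (rule monotone_on_of_deriv(1))
    have adm: "admissible_map t0 t1 T X" by (rule admissible_map_cball[OF t01 X g(2) co])
    have "has_derivative_case k Case_i X t (set_mat_mult (A t) (X t) + cball 0 (r t))" if "t \<in> {t0<..t1}" for t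
    proof -
      have t: "t0 < t" "t < T" "t \<in> {t0..T}" using that t01 by auto
      show ?thesis
        unfolding rhs[OF t(3)]
        by (rule has_derivative_case_i_cball[OF X g(2) mono t(1,2) has_real_derivative_interior[OF d[OF t(3)] t(1,2)] z(2)[OF t(3)]])
    qed
    then have diff: "diff_solution (has_derivative_case k Case_i) A r t0 t1 T X"
      using adm X0 by (simp add: diff_solution_def)
    have "X t = cball 0 1 + aumann_integral t0 t (\<lambda>s. set_mat_mult (A s) (X s)) + cball 0 (integral {t0..t} r)"
      if "t \<in> {t0..t1}" for t
    proof -
      have t: "t \<in> {t0..T}" using that sub by auto
      have "g t = 1 + integral {t0..t} (\<lambda>s. \<sigma> s * g s) + integral {t0..t} r"
        using FTC[OF d t] int_add[OF co t] by simp
      then show ?thesis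
        using int_nonneg[OF co t] R[OF t] by (simp add: X[OF t] int[OF co t] set_plus_cball)
    qed
    then have int_sol: "int_solution_i A r t0 t1 T X"
      using adm by (simp add: int_solution_i_def)
    have "mono_on {t0..t1} (\<lambda>t. diameter (X t))"
      using sub X g(2) by (intro diameter_monotone_cball(1)[where g = g] mono_on_subset[OF mono]) auto
    with diff int_sol show ?thesis
      by (simp add: first_basic_solution_def basic_solution_def has_set_derivative_diff_solution)
  qed
  show "second_basic_solution k A r t0 t1 T X"
    if d: "\<And>t. t \<in> {t0..T} \<Longrightarrow> (g has_real_derivative - (\<sigma> t * g t + r t)) (at t within {t0..T})"
  proof -
    have co: "continuous_on {t0..T} g" by (rule DERIV_continuous_on[OF d])
    have anti: "antimono_on {t0..T} g" 
      by (rule monotone_on_of_deriv(2)[OF d]) (simp_all only: neg_le_0_iff_le z(2))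
    have adm: "admissible_map t0 t1 T X" by (rule admissible_map_cball[OF t01 X g(2) co])
    have "has_derivative_case k Case_ii X t (set_mat_mult (A t) (X t) + cball 0 (r t))" if "t \<in> {t0<..t1}" for t
    proof -
      have t: "t0 < t" "t < T" "t \<in> {t0..T}" using that t01 by auto
      show ?thesis
        unfolding rhs[OF t(3)]
        by (rule has_derivative_case_ii_cball[OF X g(2) anti t(1,2) has_real_derivative_interior[OF d[OF t(3)] t(1,2)] z(2)[OF t(3)]])
    qed
    then have diff: "diff_solution (has_derivative_case k Case_ii) A r t0 t1 T X"
      using adm X0 by (simp add: diff_solution_def)
    have "X t + set_scale (kind_sign k) (aumann_integral t0 t (\<lambda>s. set_mat_mult (A s) (X s)))
        + cball 0 (integral {t0..t} r) = cball 0 1" if "t \<in> {t0..t1}" for t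
    proof -
      have t: "t \<in> {t0..T}" using that sub by auto
      have "- (integral {t0..t} (\<lambda>s. \<sigma> s * g s + r s)) = g t - 1"
        using FTC[OF d t] by (simp only: integral_neg)
      then have "g t + integral {t0..t} (\<lambda>s. \<sigma> s * g s) + integral {t0..t} r = 1"
        using int_add[OF co t] by simp
      then show ?thesis
        using int_nonneg[OF co t] R[OF t] g(2)[OF t] kind_sign(2)[of k]
        by (simp add: X[OF t] int[OF co t] set_scale_cball set_plus_cball)
    qed
    then have int_sol: "int_solution_ii k A r t0 t1 T X"
      using adm by (simp add: int_solution_ii_iff)
    have dia: "antimono_on {t0..t1} (\<lambda>t. diameter (X t))"
      using sub X g(2) by (intro diameter_monotone_cball(2)[where g = g] monotone_on_subset[OF anti]) auto
    have strict: "diameter (X t) < diameter (X s)"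
      if s: "s \<in> {t0..t1}" and t: "t \<in> {t0..t1}" and st: "s < t" and pos: "0 < diameter (X s)" for s t
    proof -
      have s': "s \<in> {t0..T}" and t': "t \<in> {t0..T}" using s t sub by auto
      have gs: "0 < g s" using pos g(2)[OF s'] by (auto simp: X[OF s'] split: if_splits)
      have "g t < g s"
      \<comment> \<open>If the radius at \<open>t\<close> is positive, it is positive on all of
        \<open>{s..t}\<close> by monotonicity, and then \<open>\<sigma> u * g u > 0\<close> makes
        the derivative strictly negative even where \<open>r\<close> vanishes.\<close>
      proof (cases "g t = 0")
        case False
        then have gt: "0 < g t" using g(2)[OF t'] by simp
        show ?thesis
        proof (rule DERIV_neg_imp_decreasing_open[OF st])
          fix u assume u: "s < u" "u < t"
          then have u': "u \<in> {t0..T}" "t0 < u" "u < T" using s' t' by auto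
          have "g t \<le> g u" using u u' t' by (intro monotone_onD[OF anti]) auto
          with gt have "0 < g u" by simp
          then have "0 < \<sigma> u * g u" using \<sigma>(2)[OF u'(1)] by simp
          then have "- (\<sigma> u * g u + r u) < 0" using r(2)[of u] by linarith
          then show "\<exists>y. (g has_real_derivative y) (at u) \<and> y < 0"
            using has_real_derivative_interior[OF d[OF u'(1)] u'(2,3)] by blast
        qed (use s' t' in \<open>auto intro: continuous_on_subset[OF co]\<close>)
      qed (use gs in simp)
      then show ?thesis using g(2)[OF s'] g(2)[OF t'] by (simp add: X[OF s'] X[OF t'])
    qed
    show ?thesis
      unfolding second_basic_solution_def basic_solution_def
      using diff int_sol dia strict by (simp add: has_set_derivative_diff_solution[OF diff])
  qed
qed

text \<open>The second radius is \<open>H t0 t * (1 - \<phi> t)\<close> with \<open>\<phi> t\<close> the integral defining \<open>\<tau>\<close>, so it is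
  nonnegative as long as \<open>\<phi>\<close> has not passed \<open>1\<close>.\<close>

lemma second_ball_radius_nonneg:
  fixes \<sigma> r :: "real \<Rightarrow> real"
  assumes \<sigma>: "continuous_on {t0..} \<sigma>" and r: "continuous_on {t0..} r" "\<And>t. 0 \<le> r t" and t0: "0 \<le> t0"
    and \<tau>: "(\<exists>\<tau>>0. T < \<tau> \<and> integral {t0..\<tau>} (\<lambda>s. exp (integral {t0..s} \<sigma>) * r s) = 1) \<or>
             (\<forall>\<tau>>0. integral {t0..\<tau>} (\<lambda>s. exp (integral {t0..s} \<sigma>) * r s) \<noteq> 1)"
    and t: "t \<in> {t0..T}"
  shows "0 \<le> ball_radius (-1) \<sigma> r t0 t"
proof -
  let ?f = "\<lambda>s. exp (integral {t0..s} \<sigma>) * r s"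
  define \<phi> where "\<phi> t = integral {t0..t} ?f" for t
  have "continuous_on {t0..b} (\<lambda>s. integral {t0..s} \<sigma>)" for b
    by (intro indefinite_integral_continuous_1 integrable_continuous_real continuous_on_subset[OF \<sigma>]) auto
  then have f: "?f integrable_on {t0..b}" for b
    by (intro integrable_continuous_real continuous_intros continuous_on_subset[OF r(1)]) auto
  have "\<phi> t \<le> 1"
    using \<tau>
  proof
    assume "\<exists>\<tau>>0. T < \<tau> \<and> integral {t0..\<tau>} ?f = 1"
    then obtain \<tau> where "T < \<tau>" "\<phi> \<tau> = 1" by (auto simp: \<phi>_def)
    moreover have "\<phi> t \<le> \<phi> \<tau>"
      unfolding \<phi>_def using t \<open>T < \<tau>\<close> by (intro integral_subset_le f) (auto simp: r)
    ultimately show ?thesis by simp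
  next
    assume no: "\<forall>\<tau>>0. integral {t0..\<tau>} ?f \<noteq> 1"
    show ?thesis
    proof (rule ccontr)
      \<comment> \<open>Since \<open>\<phi>\<close> is continuous and starts at 0, exceeding 1 would
        force the value 1 at some point after \<open>t0\<close>. That point is positive because
        \<open>t0\<close> is nonnegative, a contradiction.\<close>
      assume "\<not> \<phi> t \<le> 1"
      moreover have "\<phi> t0 = 0" by (simp add: \<phi>_def)
      moreover have "continuous_on {t0..t} \<phi>"
        unfolding \<phi>_def by (intro indefinite_integral_continuous_1 f)
      ultimately obtain \<tau> where \<tau>: "t0 \<le> \<tau>" "\<phi> \<tau> = 1"
        using IVT'[of \<phi> t0 1 t] t by auto
      with \<open>\<phi> t0 = 0\<close> have "\<tau> \<noteq> t0" by auto
      with \<tau> t0 no show False by (auto simp: \<phi>_def)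
    qed
  qed
  then show ?thesis by (simp add: ball_radius_eq[OF \<sigma>] \<phi>_def)
qed

text \<open>The entry type is general so that the result applies first to the rows and then to the
  matrix built from them.\<close>

lemma continuous_on_vector_2:
  fixes f g :: "'a::topological_space \<Rightarrow> 'b::{topological_space,zero}"
  assumes "continuous_on S f" "continuous_on S g"
  shows "continuous_on S (\<lambda>x. vector [f x, g x] :: 'b^2)"
proof -
  have eq: "(\<lambda>x. vector [f x, g x] :: 'b^2) = (\<lambda>x. \<chi> i. if i = 1 then f x else g x)"
    by (simp add: fun_eq_iff vec_eq_iff forall_2)
  have "continuous_on S (\<lambda>x. if i = 1 then f x else g x)" for i :: 2
    using assms by (cases "i = 1") auto
  then show ?thesis unfolding eq by (rule continuous_on_vec_lambda)
qed

theorem theorem3p1: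
  fixes t0 :: real and a b c d r \<sigma> :: "real \<Rightarrow> real"
    and A :: "real \<Rightarrow> real^2^2"
    and G H :: "real \<Rightarrow> real \<Rightarrow> real"
    and X1 X2 :: "real \<Rightarrow> (real^2) set"
    and k :: deriv_kind
  defines "A \<equiv> \<lambda>t. vector [vector [a t, b t], vector [c t, d t]]"
    and "G \<equiv> \<lambda>s t. exp (integral {s..t} \<sigma>)"
    and "H \<equiv> \<lambda>s t. exp (- integral {s..t} \<sigma>)"
    and "X1 \<equiv> \<lambda>t. set_scale (G t0 t + integral {t0..t} (\<lambda>s. G s t * r s)) (cball 0 1)"
    and "X2 \<equiv> \<lambda>t. set_scale (H t0 t - integral {t0..t} (\<lambda>s. H s t * r s)) (cball 0 1)"
  assumes "0 \<le> t0"
    and "continuous_on {t0..} a" "continuous_on {t0..} b"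
    and "continuous_on {t0..} c" "continuous_on {t0..} d"
    and "\<And>t. t0 \<le> t \<Longrightarrow> det (A t) \<noteq> 0"
    and "\<And>t. 0 \<le> r t" "bounded (range r)" "continuous_on UNIV r"
    and "\<And>t. t0 \<le> t \<Longrightarrow> singular_values (A t) (vector [\<sigma> t, \<sigma> t])"
  shows "(\<forall>t1 T. t0 < t1 \<and> t1 < T \<longrightarrow>
            first_basic_solution k A r t0 t1 T X1 \<and>
            (\<forall>X. diff_solution (has_derivative_case k Case_i) A r t0 t1 T X \<or>
                 int_solution_i A r t0 t1 T X \<longrightarrow> (\<forall>t\<in>{t0..t1}. X t = X1 t))) \<and>
         (\<forall>t1 T. t0 < t1 \<and> t1 < T \<and>
            ((\<exists>\<tau>>0. T < \<tau> \<and> integral {t0..\<tau>} (\<lambda>s. exp (integral {t0..s} \<sigma>) * r s) = 1) \<or>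
             (\<forall>\<tau>>0. integral {t0..\<tau>} (\<lambda>s. exp (integral {t0..s} \<sigma>) * r s) \<noteq> 1)) \<longrightarrow>
            second_basic_solution k A r t0 t1 T X2 \<and>
            (\<forall>X. diff_solution (has_derivative_case k Case_ii) A r t0 t1 T X \<or>
                 int_solution_ii k A r t0 t1 T X \<longrightarrow> (\<forall>t\<in>{t0..t1}. X t = X2 t)))"
proof -
  have A: "continuous_on {t0..} A"
    unfolding A_def by (intro continuous_on_vector_2 assms)
  have r: "continuous_on S r" "0 \<le> r t" for S t
    using assms(12,14) by (auto intro: continuous_on_subset)
  have sv: "transpose (A t) ** A t = mat ((\<sigma> t)\<^sup>2)" "\<sigma> t = sqrt \<bar>det (A t)\<bar>" if "t0 \<le> t" for t
    using equal_singular_values[OF assms(15)[OF that]] by auto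
  have \<sigma>_pos: "0 < \<sigma> t" if "t0 \<le> t" for t
    using assms(11)[OF that] by (simp add: sv(2)[OF that])
  \<comment> \<open>Continuity of \<open>\<sigma>\<close> is not assumed; it is inherited from the
    entries of \<open>A\<close> through the determinant.\<close>
  have "continuous_on {t0..} (\<lambda>t. sqrt \<bar>det (A t)\<bar>)"
    unfolding det_2 by (intro continuous_intros A)
  then have \<sigma>: "continuous_on {t0..} \<sigma>"
    by (rule continuous_on_eq) (simp add: sv(2))
  have ball: "set_mat_mult (A t) (cball 0 \<rho>) = cball 0 (\<sigma> t * \<rho>)" if "t0 \<le> t" for t \<rho>
    by (rule set_mat_mult_cball[OF sv(1)[OF that] \<sigma>_pos[OF that]])
  have \<sigma>': "continuous_on {t0..T} \<sigma>" and A': "continuous_on {t0..T} A" for T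
    by (auto intro: continuous_on_subset[OF \<sigma>] continuous_on_subset[OF A])
  have radius: "G t0 t + integral {t0..t} (\<lambda>s. G s t * r s) = ball_radius 1 \<sigma> r t0 t"
    "H t0 t - integral {t0..t} (\<lambda>s. H s t * r s) = ball_radius (-1) \<sigma> r t0 t" for t
    by (simp_all add: G_def H_def ball_radius_def)
  have init: "ball_radius e \<sigma> r t0 t0 = 1" for e by (simp add: ball_radius_def)
  \<comment> \<open>A non-integrable function has integral 0 by convention, so a case split gives
    the sign for every real \<open>t\<close>.\<close>
  have "0 \<le> integral {t0..t} (\<lambda>s. exp (1 * integral {s..t} \<sigma>) * r s)" for t
    by (cases "(\<lambda>s. exp (1 * integral {s..t} \<sigma>) * r s) integrable_on {t0..t}")
      (auto intro!: integral_nonneg simp: r not_integrable_integral)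
  then have radius1: "0 \<le> ball_radius 1 \<sigma> r t0 t" for t
    by (simp add: ball_radius_def)
  have X1: "X1 t = cball 0 (ball_radius 1 \<sigma> r t0 t)" for t
    using radius1[of t] unfolding X1_def radius by (simp add: set_scale_cball)
  show ?thesis
  proof (intro conjI allI impI ballI; (elim conjE)?)
    fix t1 T :: real assume t: "t0 < t1" "t1 < T"
    show first: "first_basic_solution k A r t0 t1 T X1"
      using ball_radius_deriv[OF \<sigma> r(1), of 1]
      by (intro first_basic_solution_cball[where \<sigma> = \<sigma> and g = "ball_radius 1 \<sigma> r t0"] t ball \<sigma>' \<sigma>_pos r init radius1 X1) auto
    fix X s
    assume "diff_solution (has_derivative_case k Case_i) A r t0 t1 T X \<or> int_solution_i A r t0 t1 T X"
      and s: "s \<in> {t0..t1}"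
    \<comment> \<open>Differential and integral solutions satisfy the same equation for support
      functions, so one uniqueness result compares either of them with \<open>X1\<close>.\<close>
    then have "supp_ode 1 1 A r t0 t1 X"
      using diff_solution_i_supp_ode[where r = r, OF r(2)] int_solution_i_supp_ode[OF A' r] by blast
    moreover have "supp_ode 1 1 A r t0 t1 X1"
      using first diff_solution_i_supp_ode[where r = r, OF r(2)] by (auto simp: first_basic_solution_def)
    ultimately show "X s = X1 s"
      using s by (intro supp_ode_unique[OF A' _ _ _ _ s]) auto
  next
    fix t1 T :: real assume t: "t0 < t1" "t1 < T"
      and \<tau>: "(\<exists>\<tau>>0. T < \<tau> \<and> integral {t0..\<tau>} (\<lambda>s. exp (integral {t0..s} \<sigma>) * r s) = 1) \<or>
             (\<forall>\<tau>>0. integral {t0..\<tau>} (\<lambda>s. exp (integral {t0..s} \<sigma>) * r s) \<noteq> 1)"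
    have radius2: "0 \<le> ball_radius (-1) \<sigma> r t0 t" if "t \<in> {t0..T}" for t
      by (rule second_ball_radius_nonneg[OF \<sigma> r assms(6) \<tau> that])
    have X2: "X2 t = cball 0 (ball_radius (-1) \<sigma> r t0 t)" if "t \<in> {t0..T}" for t
      using radius2[OF that] unfolding X2_def radius by (simp add: set_scale_cball)
    show second: "second_basic_solution k A r t0 t1 T X2"
      using ball_radius_deriv[OF \<sigma> r(1), of "-1"]
      by (intro second_basic_solution_cball[where \<sigma> = \<sigma> and g = "ball_radius (-1) \<sigma> r t0"] t ball \<sigma>' \<sigma>_pos r init radius2 X2) auto
    fix X s
    assume "diff_solution (has_derivative_case k Case_ii) A r t0 t1 T X \<or> int_solution_ii k A r t0 t1 T X"
      and s: "s \<in> {t0..t1}"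
    then have "supp_ode (-1) (kind_sign k) A r t0 t1 X"
      using diff_solution_ii_supp_ode[where r = r, OF r(2)] int_solution_ii_supp_ode[OF A' r] by blast
    moreover have "supp_ode (-1) (kind_sign k) A r t0 t1 X2"
      using second diff_solution_ii_supp_ode[where r = r, OF r(2)] by (auto simp: second_basic_solution_def)
    ultimately show "X s = X2 s"
      by (intro supp_ode_unique[OF A' _ kind_sign(2) _ _ s]) auto
  qed
qed

end
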